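(* Let $(X,Y)$ and $(V,W)$ be two Banach couples with $\operatorname{R1\text{-}Int}(X,Y)=\operatorname{R1\text{-}Int}(V,W)$. Then $(X,Y)\simeq(V,W)$, i.e. either ($X\simeq V$ and $Y\simeq W$) or ($X\simeq W$ and $Y\simeq V$).
   Context: All Banach spaces are over the same scalar field ($\mathbb{R}$ or $\mathbb{C}$). $E\hookrightarrow F$ means that the Banach space $E$ is a linear subspace of the Banach space $F$ and the inclusion is continuous. $E\simeq F$ means that $E$ and $F$ coincide as linear spaces and their norms are equivalent. A Banach couple $(X,Y)$ is a pair of Banach spaces, both linearly and continuously embedded (as linear subspaces) in some Hausdorff topological vector space. $X\cap Y$ is a Banach space with norm $\|z\|_{X\cap Y}=\max\{\|z\|_X,\|z\|_Y\}$, and $X+Y$ is a Banach space with norm $\|z\|_{X+Y}=\inf\{\|x\|_X+\|y\|_Y: x\in X,\ y\in Y,\ z=x+y\}$. $\operatorname{I}(X,Y)$ is the collection of intermediate spaces, i.e. Banach spaces $Z$ with $X\cap Y\hookrightarrow Z\hookrightarrow X+Y$. $L((X,Y))$ is the set of linear operators $T$ in $X+Y$ that map $X$ into $X$ and $Y$ into $Y$ boundedly, with norm $\|T\|_{L((X,Y))}=\max\{\|T\|_{X\to X},\|T\|_{Y\to Y}\}$. $R1((X,Y))$ is the subset of operators of rank one in $L((X,Y))$. $\operatorname{R1\text{-}Int}(X,Y)$ (interpolation spaces for the operators of rank one) is the collection of all $Z\in\operatorname{I}(X,Y)$ such that $T(Z)\subset Z$ for every $T\in R1((X,Y))$ and there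 is a constant $C>0$ with $\|T\|_{Z\to Z}\le C\|T\|_{L((X,Y))}$ for all $T\in R1((X,Y))$. *)

theory Defs
  imports "HOL-Analysis.Analysis"
begin

text \<open>The instances of this class are exactly the fields of real and of complex numbers, up to
  isometric isomorphism.  (In the second case the norm is forced to be the usual absolute value,
  since it is multiplicative and extends the absolute value on the reals.)\<close>

class real_or_complex_field = real_normed_field +
  assumes real_or_complex:
    "(\<forall>z. \<exists>a. z = a *\<^sub>R 1) \<or>
     (\<exists>i. i * i = - 1 \<and> (\<forall>z. \<exists>a b. z = a *\<^sub>R 1 + b *\<^sub>R i))"

instance real :: real_or_complex_field
  by standard auto

instance complex :: real_or_complex_field
proof
  have "\<i> * \<i> = - 1 \<and> (\<forall>z. \<exists>a b. z = a *\<^sub>R 1 + b *\<^sub>R \<i>)"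
    by (auto simp: complex_eq_iff)
  then show "(\<forall>z::complex. \<exists>a. z = a *\<^sub>R 1) \<or>
      (\<exists>i::complex. i * i = - 1 \<and> (\<forall>z. \<exists>a b. z = a *\<^sub>R 1 + b *\<^sub>R i))"
    by blast
qed

text \<open>A normed space is a linear subspace of the vector space carried by the type \<open>'a\<close>, together
  with a norm on it.  The norm is required to be \<open>0\<close> off the carrier, so that two such
  records are equal if and only if they describe the same normed space.\<close>

record 'a nspace =
  carr :: "'a set"
  nrm :: "'a \<Rightarrow> real"

definition normed_space :: "('k::real_or_complex_field \<Rightarrow> 'a::ab_group_add \<Rightarrow> 'a) \<Rightarrow> 'a nspace \<Rightarrow> bool" where
  "normed_space smul E \<longleftrightarrow>
     module.subspace smul (carr E) \<and>
     (\<forall>x\<in>carr E. 0 \<le> nrm E x \<and> (nrm E x = 0 \<longleftrightarrow> x = 0)) \<and>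
     (\<forall>x\<in>carr E. \<forall>y\<in>carr E. nrm E (x + y) \<le> nrm E x + nrm E y) \<and>
     (\<forall>c. \<forall>x\<in>carr E. nrm E (smul c x) = norm c * nrm E x) \<and>
     (\<forall>x. x \<notin> carr E \<longrightarrow> nrm E x = 0)"

definition ndist :: "'a::ab_group_add nspace \<Rightarrow> 'a \<Rightarrow> 'a \<Rightarrow> real" where
  "ndist E x y = nrm E (x - y)"

definition ntopology :: "'a::ab_group_add nspace \<Rightarrow> 'a topology" where
  "ntopology E = Metric_space.mtopology (carr E) (ndist E)"

lemma Metric_space_ndist:
  fixes smul :: "'k::real_or_complex_field \<Rightarrow> 'a::ab_group_add \<Rightarrow> 'a"
  assumes vs: "vector_space smul" and E: "normed_space smul E"
  shows "Metric_space (carr E) (ndist E)"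
proof -
  interpret vector_space smul by (rule vs)
  have sub: "subspace (carr E)" using E by (simp add: normed_space_def)
  show ?thesis
  proof
    fix x y
    show "0 \<le> ndist E x y"
      using E unfolding normed_space_def ndist_def by (metis order_refl)
    have "nrm E (- z) = nrm E z" for z
    proof (cases "z \<in> carr E")
      case True
      then have "nrm E (smul (- 1) z) = norm (- 1 :: 'k) * nrm E z"
        using E unfolding normed_space_def by blast
      then show ?thesis by simp
    next
      case False
      then have "- z \<notin> carr E"
        using subspace_neg[OF sub, of "- z"] by auto
      with False E show ?thesis by (simp add: normed_space_def)
    qed
    from this[of "x - y"] show "ndist E x y = ndist E y x"
      by (simp add: ndist_def)
  next
    fix x y assume "x \<in> carr E" "y \<in> carr E"
    then have "x - y \<in> carr E" using sub by (simp add: subspace_diff)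
    then show "ndist E x y = 0 \<longleftrightarrow> x = y"
      using E by (simp add: normed_space_def ndist_def)
  next
    fix x y z assume "x \<in> carr E" "y \<in> carr E" "z \<in> carr E"
    then have "x - y \<in> carr E" "y - z \<in> carr E" using sub by (simp_all add: subspace_diff)
    then have "nrm E ((x - y) + (y - z)) \<le> nrm E (x - y) + nrm E (y - z)"
      using E unfolding normed_space_def by blast
    then show "ndist E x z \<le> ndist E x y + ndist E y z"
      by (simp add: ndist_def)
  qed
qed

definition banach_space :: "('k::real_or_complex_field \<Rightarrow> 'a::ab_group_add \<Rightarrow> 'a) \<Rightarrow> 'a nspace \<Rightarrow> bool" where
  "banach_space smul E \<longleftrightarrow>
     normed_space smul E \<and> Metric_space.mcomplete (carr E) (ndist E)"

text \<open>\<open>E \<hookrightarrow> F\<close>\<close>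

definition embedded :: "'a::ab_group_add nspace \<Rightarrow> 'a nspace \<Rightarrow> bool" where
  "embedded E F \<longleftrightarrow>
     carr E \<subseteq> carr F \<and> continuous_map (ntopology E) (ntopology F) (\<lambda>x. x)"

text \<open>\<open>E \<simeq> F\<close>\<close>

definition space_equiv :: "'a nspace \<Rightarrow> 'a nspace \<Rightarrow> bool" where
  "space_equiv E F \<longleftrightarrow>
     carr E = carr F \<and>
     (\<exists>c>0. \<exists>C>0. \<forall>x\<in>carr E. c * nrm E x \<le> nrm F x \<and> nrm F x \<le> C * nrm E x)"

definition hausdorff_vector_topology ::
    "('k::real_or_complex_field \<Rightarrow> 'a::ab_group_add \<Rightarrow> 'a) \<Rightarrow> 'a topology \<Rightarrow> bool" where
  "hausdorff_vector_topology smul \<T> \<longleftrightarrow>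
     topspace \<T> = UNIV \<and> Hausdorff_space \<T> \<and>
     continuous_map (prod_topology \<T> \<T>) \<T> (\<lambda>(x, y). x + y) \<and>
     continuous_map (prod_topology euclidean \<T>) \<T> (\<lambda>(c, x). smul c x)"

text \<open>The ambient topology is part of the existential, so different couples may use different
  ones.  Taking the whole type as ambient space is no restriction: a Hausdorff vector topology on
  a linear subspace extends to the whole space (add any Hausdorff vector topology on an
  algebraic complement).\<close>

definition banach_couple ::
    "('k::real_or_complex_field \<Rightarrow> 'a::ab_group_add \<Rightarrow> 'a) \<Rightarrow> 'a nspace \<Rightarrow> 'a nspace \<Rightarrow> bool" where
  "banach_couple smul X Y \<longleftrightarrow>
     banach_space smul X \<and> banach_space smul Y \<and>
     (\<exists>\<T>. hausdorff_vector_topology smul \<T> \<and>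
          continuous_map (ntopology X) \<T> (\<lambda>x. x) \<and> continuous_map (ntopology Y) \<T> (\<lambda>y. y))"

definition inter_space :: "'a nspace \<Rightarrow> 'a nspace \<Rightarrow> 'a nspace" where
  "inter_space X Y =
     \<lparr>carr = carr X \<inter> carr Y,
      nrm = (\<lambda>z. if z \<in> carr X \<inter> carr Y then max (nrm X z) (nrm Y z) else 0)\<rparr>"

definition sum_carr :: "'a::ab_group_add nspace \<Rightarrow> 'a nspace \<Rightarrow> 'a set" where
  "sum_carr X Y = {x + y | x y. x \<in> carr X \<and> y \<in> carr Y}"

definition sum_space :: "'a::ab_group_add nspace \<Rightarrow> 'a nspace \<Rightarrow> 'a nspace" where
  "sum_space X Y =
     \<lparr>carr = sum_carr X Y,
      nrm = (\<lambda>z. if z \<in> sum_carr X Y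
                 then Inf {nrm X x + nrm Y y | x y. x \<in> carr X \<and> y \<in> carr Y \<and> z = x + y}
                 else 0)\<rparr>"

definition intermediate ::
    "('k::real_or_complex_field \<Rightarrow> 'a::ab_group_add \<Rightarrow> 'a) \<Rightarrow> 'a nspace \<Rightarrow> 'a nspace \<Rightarrow> 'a nspace set" where
  "intermediate smul X Y =
     {Z. banach_space smul Z \<and> embedded (inter_space X Y) Z \<and> embedded Z (sum_space X Y)}"

text \<open>Operators are functions on the whole type of which only the values on the space in question
  matter.\<close>

definition linear_operator_in ::
    "('k \<Rightarrow> 'a::ab_group_add \<Rightarrow> 'a) \<Rightarrow> 'a set \<Rightarrow> ('a \<Rightarrow> 'a) \<Rightarrow> bool" where
  "linear_operator_in smul S T \<longleftrightarrow>
     T ` S \<subseteq> S \<and>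
     (\<forall>x\<in>S. \<forall>y\<in>S. T (x + y) = T x + T y) \<and>
     (\<forall>c. \<forall>x\<in>S. T (smul c x) = smul c (T x))"

definition maps_boundedly :: "'a nspace \<Rightarrow> ('a \<Rightarrow> 'a) \<Rightarrow> bool" where
  "maps_boundedly E T \<longleftrightarrow>
     T ` carr E \<subseteq> carr E \<and> (\<exists>B. \<forall>x\<in>carr E. nrm E (T x) \<le> B * nrm E x)"

text \<open>Only meaningful for operators that map \<open>E\<close> boundedly into itself; otherwise the supremum
  is a junk value.\<close>

definition op_norm :: "'a nspace \<Rightarrow> ('a \<Rightarrow> 'a) \<Rightarrow> real" where
  "op_norm E T = (SUP x\<in>{x \<in> carr E. nrm E x \<le> 1}. nrm E (T x))"

definition couple_ops ::
    "('k \<Rightarrow> 'a::ab_group_add \<Rightarrow> 'a) \<Rightarrow> 'a nspace \<Rightarrow> 'a nspace \<Rightarrow> ('a \<Rightarrow> 'a) set" where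
  "couple_ops smul X Y =
     {T. linear_operator_in smul (carr (sum_space X Y)) T \<and>
         maps_boundedly X T \<and> maps_boundedly Y T}"

definition couple_op_norm :: "'a nspace \<Rightarrow> 'a nspace \<Rightarrow> ('a \<Rightarrow> 'a) \<Rightarrow> real" where
  "couple_op_norm X Y T = max (op_norm X T) (op_norm Y T)"

definition rank_one_ops ::
    "('k::real_or_complex_field \<Rightarrow> 'a::ab_group_add \<Rightarrow> 'a) \<Rightarrow> 'a nspace \<Rightarrow> 'a nspace \<Rightarrow> ('a \<Rightarrow> 'a) set" where
  "rank_one_ops smul X Y =
     {T \<in> couple_ops smul X Y. vector_space.dim smul (T ` carr (sum_space X Y)) = 1}"

definition R1_Int ::
    "('k::real_or_complex_field \<Rightarrow> 'a::ab_group_add \<Rightarrow> 'a) \<Rightarrow> 'a nspace \<Rightarrow> 'a nspace \<Rightarrow> 'a nspace set" where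
  "R1_Int smul X Y =
     {Z \<in> intermediate smul X Y.
        \<exists>C>0. \<forall>T\<in>rank_one_ops smul X Y.
          maps_boundedly Z T \<and> op_norm Z T \<le> C * couple_op_norm X Y T}"

end

theory Submission
  imports Defs
begin

text \<open>Write \<open>E \<le> F\<close> for a bounded inclusion of normed spaces.  An interpolation space \<open>Z\<close> for the
  operators of rank one is controlled by the functional
  \<open>K(s, z) = inf {\<parallel>x\<parallel>\<^sub>X + s \<parallel>y\<parallel>\<^sub>Y | z = x + y}\<close>.  For \<open>s \<ge> 0\<close> and \<open>z \<in> Z\<close>, the Hahn--Banach theorem gives
  a functional \<open>f\<close> on \<open>X + Y\<close> with \<open>\<bar>f\<bar> \<le> K(s, _)\<close> and \<open>\<bar>f(z)\<bar> = K(s, z)\<close>; it has norm at most \<open>1\<close> on \<open>X\<close> and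
  at most \<open>s\<close> on \<open>Y\<close>.  Interpolating the operator \<open>f \<otimes> a\<close> and applying it to \<open>z\<close> yields
  \<open>K(s, z) \<parallel>a\<parallel>\<^sub>Z \<le> C max(\<parallel>a\<parallel>\<^sub>X, s \<parallel>a\<parallel>\<^sub>Y) \<parallel>z\<parallel>\<^sub>Z\<close>
  for all \<open>a \<in> X \<inter> Y\<close>, and for \<open>s = 0\<close> even for all \<open>a \<in> X\<close>, because then \<open>f\<close> vanishes on \<open>Y\<close>
  (\<open>rank_one_interpolation_estimate\<close>).

  The core is \<open>bounded_inclusion_into_one_of_two\<close>: if \<open>X \<le> Y\<close> fails, then \<open>X \<le> V\<close> or \<open>X \<le> W\<close>.  The number
  \<open>K(0, x)\<close> is the distance in \<open>X\<close> from \<open>x\<close> to \<open>X \<inter> Y\<close>, so there are two cases.  If \<open>X \<inter> Y\<close> is not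
  dense in \<open>X\<close>, then \<open>K(0, _)\<close> does not vanish on \<open>X \<subseteq> V + W\<close>, hence not on \<open>V\<close> or not on \<open>W\<close>, and the
  estimate with \<open>s = 0\<close> includes \<open>X\<close> in that space.  If \<open>X \<inter> Y\<close> is dense in \<open>X\<close>, then for one \<open>Z\<close> of
  the two spaces the ratios \<open>K(s, z) / \<parallel>z\<parallel>\<^sub>Z\<close> must reach a fixed bound \<open>c > 0\<close> for every \<open>s > 0\<close>:
  otherwise \<open>K(s, _)\<close> would, for some \<open>s\<close>, be small against the norm of \<open>V + W\<close>, hence against that of
  \<open>X\<close>, and repeatedly splitting off a part in \<open>Y\<close> would give \<open>X \<le> Y\<close>.  For this \<open>Z\<close>, letting \<open>s\<close> tend to
  \<open>0\<close> in the estimate bounds \<open>\<parallel>_\<parallel>\<^sub>Z\<close> by \<open>\<parallel>_\<parallel>\<^sub>X\<close> on \<open>X \<inter> Y\<close>, and density extends this to \<open>X \<le> Z\<close>.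

  By symmetry the same dichotomy holds for each of the four spaces.  Moreover, since the couples have
  the same intermediate spaces, \<open>X \<inter> Y\<close> and \<open>V \<inter> W\<close> have the same lower bounds among the four spaces,
  and \<open>X + Y\<close> and \<open>V + W\<close> the same upper bounds.  From here the theorem is a statement about
  preorders (\<open>pairs_match_in_preorder\<close>).\<close>

section \<open>The Hahn--Banach theorem for seminorms\<close>

text \<open>Linear functionals on subspaces are represented by their graphs, so that the union of a chain is
  again an element.  Domination by \<open>p\<close> already makes such a graph single-valued: it bounds both the
  difference of two values at the same point and its negative by \<open>p 0 = 0\<close>.\<close>

lemma Hahn_Banach_real:
  fixes scale :: "real \<Rightarrow> 'a::ab_group_add \<Rightarrow> 'a" and p :: "'a \<Rightarrow> real"
  assumes vs: "vector_space scale" and S: "module.subspace scale S"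
    and sub: "\<And>x y. x \<in> S \<Longrightarrow> y \<in> S \<Longrightarrow> p (x + y) \<le> p x + p y"
    and hom: "\<And>t x. 0 \<le> t \<Longrightarrow> x \<in> S \<Longrightarrow> p (scale t x) = t * p x"
    and z: "z \<in> S"
  obtains g :: "'a \<Rightarrow> real" where
    "\<And>x y. x \<in> S \<Longrightarrow> y \<in> S \<Longrightarrow> g (x + y) = g x + g y"
    "\<And>t x. x \<in> S \<Longrightarrow> g (scale t x) = t * g x"
    "\<And>x. x \<in> S \<Longrightarrow> g x \<le> p x"
    "g z = p z"
proof -
  interpret vector_space scale by (rule vs)
  note S_simps = subspace_add[OF S] subspace_scale[OF S] subspace_diff[OF S] subspace_0[OF S]
  have p0: "p 0 = 0" using hom[of 0 0] S_simps by simp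
  define lin where "lin G \<longleftrightarrow> G \<subseteq> S \<times> UNIV \<and>
      (\<forall>x r y r'. (x, r) \<in> G \<longrightarrow> (y, r') \<in> G \<longrightarrow> (x + y, r + r') \<in> G) \<and>
      (\<forall>t x r. (x, r) \<in> G \<longrightarrow> (scale t x, t * r) \<in> G) \<and>
      (\<forall>x r. (x, r) \<in> G \<longrightarrow> r \<le> p x)" for G
  define \<G> where "\<G> = {G. lin G \<and> (z, p z) \<in> G}"
  have dom: "r \<le> p x" if "lin G" "(x, r) \<in> G" for G x r
    using that unfolding lin_def by blast
  have inS: "x \<in> S" if "lin G" "(x, r) \<in> G" for G x r
    using that unfolding lin_def by blast
  have add: "(x + y, r + r') \<in> G" if "lin G" "(x, r) \<in> G" "(y, r') \<in> G" for G x r y r'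
    using that unfolding lin_def by blast
  have scl: "(scale t x, t * r) \<in> G" if "lin G" "(x, r) \<in> G" for G t x r
    using that unfolding lin_def by blast
  let ?G0 = "range (\<lambda>t. (scale t z, t * p z))"
  have "t * p z \<le> p (scale t z)" for t
  proof (cases "0 \<le> t")
    case True then show ?thesis using hom z by simp
  next
    case False
    have "p (scale t z + scale (- t) z) \<le> p (scale t z) + p (scale (- t) z)"
      by (intro sub S_simps z)
    then show ?thesis using False hom[of "- t" z] z p0 by simp
  qed
  then have "lin ?G0"
    unfolding lin_def using z S_simps by (auto simp: scale_left_distrib[symmetric] distrib_right[symmetric] )
  moreover have "(z, p z) \<in> ?G0" by (rule image_eqI[of _ _ 1]) simp_all
  ultimately have "?G0 \<in> \<G>" by (simp add: \<G>_def)
  then have ne: "\<G> \<noteq> {}" by blast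
  have chain: "\<Union>\<C> \<in> \<G>" if "\<C> \<noteq> {}" "subset.chain \<G> \<C>" for \<C>
  proof -
    have lC: "lin G" "(z, p z) \<in> G" if "G \<in> \<C>" for G
      using that \<open>subset.chain \<G> \<C>\<close> by (auto simp: subset.chain_def \<G>_def)
    have "(x + y, r + r') \<in> \<Union>\<C>" if "(x, r) \<in> \<Union>\<C>" "(y, r') \<in> \<Union>\<C>" for x r y r'
    proof -
      obtain G H where GH: "G \<in> \<C>" "(x, r) \<in> G" "H \<in> \<C>" "(y, r') \<in> H" using \<open>(x, r) \<in> \<Union>\<C>\<close> \<open>(y, r') \<in> \<Union>\<C>\<close> by blast
      then have "G \<subseteq> H \<or> H \<subseteq> G" using \<open>subset.chain \<G> \<C>\<close> by (auto simp: subset.chain_def)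
      then show ?thesis using GH add[OF lC(1)] by blast
    qed
    then have "lin (\<Union>\<C>)"
      unfolding lin_def using scl[OF lC(1)] dom[OF lC(1)] inS[OF lC(1)] by fast
    then show ?thesis using \<open>\<C> \<noteq> {}\<close> lC(2) by (auto simp: \<G>_def)
  qed
  obtain M where M: "M \<in> \<G>" and max: "\<And>G. G \<in> \<G> \<Longrightarrow> M \<subseteq> G \<Longrightarrow> G = M"
    using subset_Zorn_nonempty[OF ne chain] by blast
  have lM: "lin M" and zM: "(z, p z) \<in> M" using M by (auto simp: \<G>_def)
  have M0: "(0, 0) \<in> M" using scl[OF lM zM, of 0] by simp
  have diff: "(x - y, r - r') \<in> M" if "(x, r) \<in> M" "(y, r') \<in> M" for x r y r'
    using add[OF lM that(1) scl[OF lM that(2), of "- 1"]] by simp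
  have uniq: "r = r'" if "(x, r) \<in> M" "(x, r') \<in> M" for x r r'
    using dom[OF lM diff[OF that]] dom[OF lM diff[OF that(2) that(1)]] p0 by simp
  have total: "\<exists>r. (x, r) \<in> M" if x: "x \<in> S" for x
  proof -
    have "r - p (y - x) \<le> p (y' + x) - r'" if "(y, r) \<in> M" "(y', r') \<in> M" for y r y' r'
    proof -
      have yS: "y \<in> S" "y' \<in> S" using that inS[OF lM] by auto
      have "r + r' \<le> p (y + y')" using dom[OF lM add[OF lM that]] .
      also have "\<dots> = p ((y - x) + (y' + x))" by simp
      also have "\<dots> \<le> p (y - x) + p (y' + x)" by (intro sub S_simps yS x)
      finally show ?thesis by simp
    qed
    note cut = this
    \<comment> \<open>The value to be given to \<open>x\<close> has to lie between the two sides of the preceding inequality.\<close>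
    define c where "c = (SUP (y, r)\<in>M. r - p (y - x))"
    have bdd: "bdd_above ((\<lambda>(y, r). r - p (y - x)) ` M)"
      unfolding bdd_above_def using cut[OF _ M0] by fastforce
    have c_ge: "r - p (y - x) \<le> c" if "(y, r) \<in> M" for y r
      unfolding c_def using cSUP_upper[OF that bdd] by simp
    have c_le: "c \<le> p (y + x) - r" if "(y, r) \<in> M" for y r
      unfolding c_def by (rule cSUP_least) (use M0 cut[OF _ that] in auto)
    define G where "G = {(y + scale t x, r + t * c) | y r t. (y, r) \<in> M}"
    have GI: "(y + scale t x, r + t * c) \<in> G" if "(y, r) \<in> M" for y r t
      using that unfolding G_def by blast
    have dG: "r + t * c \<le> p (y + scale t x)" if yr: "(y, r) \<in> M" for y r t
    proof -
      have yS: "y \<in> S" using yr inS[OF lM] by auto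
      consider "t = 0" | "t > 0" | "t < 0" by linarith
      then show ?thesis
      proof cases
        case 1 then show ?thesis using dom[OF lM yr] by simp
      next
        case 2
        have "c \<le> p (scale (1/t) y + x) - (1/t) * r" using c_le[OF scl[OF lM yr]] .
        then have "t * c \<le> t * p (scale (1/t) y + x) - r"
          using 2 by (simp add: field_simps)
        also have "t * p (scale (1/t) y + x) = p (scale t (scale (1/t) y + x))"
          using 2 by (intro hom[symmetric] S_simps yS x) auto
        also have "scale t (scale (1/t) y + x) = y + scale t x"
          using 2 by (simp add: scale_right_distrib)
        finally show ?thesis by simp
      next
        case 3
        have "(1/(-t)) * r - p (scale (1/(-t)) y - x) \<le> c" using c_ge[OF scl[OF lM yr]] .
        then have "(- t) * ((1/(-t)) * r - p (scale (1/(-t)) y - x)) \<le> (- t) * c"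
          using 3 by (intro mult_left_mono) auto
        moreover have "(- t) * ((1/(-t)) * r - p (scale (1/(-t)) y - x)) = r - (- t) * p (scale (1/(-t)) y - x)"
          using 3 by (simp add: field_simps)
        moreover have "(- t) * p (scale (1/(-t)) y - x) = p (scale (- t) (scale (1/(-t)) y - x))"
          using 3 by (intro hom[symmetric] S_simps yS x) auto
        moreover have "scale (- t) (scale (1/(-t)) y - x) = y + scale t x"
          using 3 by (simp add: scale_right_diff_distrib)
        ultimately show ?thesis by simp
      qed
    qed
    have "lin G" unfolding lin_def
    proof (intro conjI allI impI)
      show "G \<subseteq> S \<times> UNIV" unfolding G_def using S_simps x inS[OF lM] by auto
    next
      fix a r b r' assume "(a, r) \<in> G" "(b, r') \<in> G"
      then obtain y1 r1 t1 y2 r2 t2 where *: "(y1, r1) \<in> M" "a = y1 + scale t1 x" "r = r1 + t1 * c"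
        "(y2, r2) \<in> M" "b = y2 + scale t2 x" "r' = r2 + t2 * c" unfolding G_def by blast
      have "((y1 + y2) + scale (t1 + t2) x, (r1 + r2) + (t1 + t2) * c) \<in> G"
        by (intro GI add[OF lM] *)
      then show "(a + b, r + r') \<in> G" using * by (simp add: scale_left_distrib algebra_simps)
    next
      fix t a r assume "(a, r) \<in> G"
      then obtain y1 r1 t1 where *: "(y1, r1) \<in> M" "a = y1 + scale t1 x" "r = r1 + t1 * c"
        unfolding G_def by blast
      have "(scale t y1 + scale (t * t1) x, t * r1 + (t * t1) * c) \<in> G"
        by (intro GI scl[OF lM] *)
      then show "(scale t a, t * r) \<in> G" using * by (simp add: scale_right_distrib algebra_simps)
    next
      fix a r assume "(a, r) \<in> G" then show "r \<le> p a" unfolding G_def using dG by auto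
    qed
    moreover have "M \<subseteq> G" using GI[of _ _ 0] by auto
    ultimately have "G = M" using max zM by (auto simp: \<G>_def)
    moreover have "(x, c) \<in> G" using GI[OF M0, of 1] by simp
    ultimately show ?thesis by blast
  qed
  define g where "g x = (THE r. (x, r) \<in> M)" for x
  have g_eq: "g x = r" if "(x, r) \<in> M" for x r
    unfolding g_def using that uniq by blast
  have gM: "(x, g x) \<in> M" if "x \<in> S" for x
    using total[OF that] g_eq by blast
  show ?thesis
  proof
    show "g (x + y) = g x + g y" if "x \<in> S" "y \<in> S" for x y
      by (intro g_eq add[OF lM] gM that)
    show "g (scale t x) = t * g x" if "x \<in> S" for t x
      by (intro g_eq scl[OF lM] gM that)
    show "g x \<le> p x" if "x \<in> S" for x by (rule dom[OF lM gM[OF that]])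
    show "g z = p z" by (rule g_eq[OF zM])
  qed
qed

text \<open>Multiplicativity determines the norm.  That it cannot exceed the modulus
  \<open>sqrt (a\<^sup>2 + b\<^sup>2)\<close> follows by comparing powers: both are multiplicative and the norm is at most
  \<open>\<bar>a\<bar> + \<bar>b\<bar>\<close>, so a quotient above \<open>1\<close> would have unbounded powers.  Applied to the conjugate, this
  gives the lower bound, since the product of a number with its conjugate is the squared modulus.\<close>

lemma abs_real_part_le_norm:
  fixes i :: "'k::real_normed_field"
  assumes i: "i * i = - 1"
  shows "\<bar>a\<bar> \<le> norm (of_real a + of_real b * i)"
proof -
  have "norm i * norm i = 1" by (simp flip: norm_mult add: i)
  then have ni: "norm i = 1"
    by (metis abs_norm_cancel abs_square_eq_1 power2_eq_square)
  have upper: "(norm (of_real a + of_real b * i))\<^sup>2 \<le> a\<^sup>2 + b\<^sup>2" for a b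
  proof (rule ccontr)
    define w where "w = of_real a + of_real b * i"
    define m where "m = a\<^sup>2 + b\<^sup>2"
    assume "\<not> (norm (of_real a + of_real b * i))\<^sup>2 \<le> a\<^sup>2 + b\<^sup>2"
    then have gt: "(norm w)\<^sup>2 > m" by (simp add: w_def m_def)
    have "m \<noteq> 0" using gt by (auto simp: m_def w_def sum_power2_eq_zero_iff)
    then have m: "m > 0" by (simp add: m_def sum_power2_gt_zero_iff)
    have pow: "\<exists>A B. w ^ n = of_real A + of_real B * i \<and> A\<^sup>2 + B\<^sup>2 = m ^ n" for n
    proof (induction n)
      case 0
      show ?case by (rule exI[of _ 1], rule exI[of _ 0]) simp
    next
      case (Suc n)
      then obtain A B where AB: "w ^ n = of_real A + of_real B * i" "A\<^sup>2 + B\<^sup>2 = m ^ n" by blast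
      have "w ^ Suc n = (of_real a + of_real b * i) * (of_real A + of_real B * i)"
        by (simp add: AB(1)) (simp add: w_def)
      also have "\<dots> = of_real (a * A) + of_real (a * B + b * A) * i + of_real (b * B) * (i * i)"
        by (simp add: algebra_simps)
      also have "\<dots> = of_real (a * A - b * B) + of_real (a * B + b * A) * i"
        by (simp add: i)
      finally have "w ^ Suc n = of_real (a * A - b * B) + of_real (a * B + b * A) * i" .
      moreover have "(a * A - b * B)\<^sup>2 + (a * B + b * A)\<^sup>2 = m * (A\<^sup>2 + B\<^sup>2)"
        by (simp add: m_def power2_eq_square algebra_simps)
      ultimately show ?case using AB by fastforce
    qed
    have bound: "((norm w)\<^sup>2 / m) ^ n \<le> 2" for n
    proof -
      obtain A B where AB: "w ^ n = of_real A + of_real B * i" "A\<^sup>2 + B\<^sup>2 = m ^ n" using pow by blast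
      have "norm (w ^ n) \<le> \<bar>A\<bar> + \<bar>B\<bar>"
        unfolding AB(1) by (rule order_trans[OF norm_triangle_ineq]) (simp add: norm_mult ni)
      then have "(norm (w ^ n))\<^sup>2 \<le> (\<bar>A\<bar> + \<bar>B\<bar>)\<^sup>2" by (simp add: power_mono)
      also have "\<dots> \<le> 2 * (A\<^sup>2 + B\<^sup>2)"
        using sum_squares_bound[of "\<bar>A\<bar>" "\<bar>B\<bar>"] by (simp add: power2_sum)
      finally have "((norm w)\<^sup>2) ^ n \<le> 2 * m ^ n"
        by (simp only: AB(2) norm_power power_mult[symmetric] mult.commute)
      then show ?thesis using m by (simp add: power_divide divide_le_eq)
    qed
    have "1 < (norm w)\<^sup>2 / m" using gt m by simp
    then obtain n where "2 < ((norm w)\<^sup>2 / m) ^ n" using real_arch_pow by blast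
    with bound[of n] show False by simp
  qed
  define w where "w = of_real a + of_real b * i"
  define w' where "w' = of_real a + of_real (- b) * i"
  have "w * w' = of_real (a * a) - of_real (b * b) * (i * i)"
    by (simp add: w_def w'_def algebra_simps)
  also have "\<dots> = of_real (a\<^sup>2 + b\<^sup>2)" by (simp add: i power2_eq_square)
  finally have "norm w * norm w' = a\<^sup>2 + b\<^sup>2"
    by (metis abs_of_nonneg norm_mult norm_of_real sum_power2_ge_zero)
  then have eq: "(norm w)\<^sup>2 * (norm w')\<^sup>2 = (a\<^sup>2 + b\<^sup>2)\<^sup>2" by (metis power_mult_distrib)
  have "(norm w')\<^sup>2 \<le> a\<^sup>2 + b\<^sup>2" using upper[of a "- b"] by (simp add: w'_def)
  then have le: "(a\<^sup>2 + b\<^sup>2)\<^sup>2 \<le> (norm w)\<^sup>2 * (a\<^sup>2 + b\<^sup>2)"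
    unfolding eq[symmetric] by (simp add: mult_left_mono)
  have "a\<^sup>2 \<le> (norm w)\<^sup>2"
  proof (cases "a = 0")
    case False
    then have "a\<^sup>2 + b\<^sup>2 > 0" by (simp add: sum_power2_gt_zero_iff)
    then have "a\<^sup>2 + b\<^sup>2 \<le> (norm w)\<^sup>2" using le by (simp add: power2_eq_square)
    then show ?thesis by (smt (verit) zero_le_power2)
  qed simp
  then show ?thesis by (simp add: w_def flip: abs_le_square_iff)
qed

locale rc_vector_space = vector_space smul
  for smul :: "'k::real_or_complex_field \<Rightarrow> 'a::ab_group_add \<Rightarrow> 'a"
begin

text \<open>For complex scalars the functional is recovered from its real part \<open>g\<close> as \<open>g x - i g (i x)\<close>, and
  the bound on the real part carries over after rotating \<open>x\<close> so that the value becomes a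
  nonnegative real.\<close>

lemma Hahn_Banach_seminorm:
  fixes p :: "'a \<Rightarrow> real"
  assumes S: "subspace S"
    and sub: "\<And>x y. x \<in> S \<Longrightarrow> y \<in> S \<Longrightarrow> p (x + y) \<le> p x + p y"
    and hom: "\<And>c x. x \<in> S \<Longrightarrow> p (smul c x) = norm c * p x"
    and z: "z \<in> S"
  obtains f :: "'a \<Rightarrow> 'k" where
    "\<And>x y. x \<in> S \<Longrightarrow> y \<in> S \<Longrightarrow> f (x + y) = f x + f y"
    "\<And>c x. x \<in> S \<Longrightarrow> f (smul c x) = c * f x"
    "\<And>x. x \<in> S \<Longrightarrow> norm (f x) \<le> p x"
    "p z \<le> norm (f z)"
proof -
  let ?r = "\<lambda>t x. smul (of_real t) x"
  have vs: "vector_space ?r"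
    by unfold_locales (simp_all add: scale_right_distrib scale_left_distrib)
  interpret R: vector_space ?r by (rule vs)
  have RS: "R.subspace S"
    using S by (simp add: R.subspace_def subspace_def)
  have hom_real: "p (?r t x) = t * p x" if "0 \<le> t" "x \<in> S" for t x
    using that by (simp add: hom)
  show thesis
  proof (rule Hahn_Banach_real[OF vs RS sub hom_real z])
    fix g
    assume g: "\<And>x y. x \<in> S \<Longrightarrow> y \<in> S \<Longrightarrow> g (x + y) = g x + g y"
      "\<And>t x. x \<in> S \<Longrightarrow> g (?r t x) = t * g x"
      "\<And>x. x \<in> S \<Longrightarrow> g x \<le> p x" "g z = p z"
    note S_simps = subspace_add[OF S] subspace_scale[OF S]
    show thesis
    proof (cases "\<forall>c::'k. \<exists>a. c = a *\<^sub>R 1")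
      case True
      have c: "\<exists>a. c = of_real a" for c :: 'k using True by (simp add: of_real_def)
      show ?thesis
      proof
        show "of_real (g (x + y)) = (of_real (g x) + of_real (g y) :: 'k)" if "x \<in> S" "y \<in> S" for x y
          using g(1)[OF that] by simp
        show "of_real (g (smul c x)) = c * of_real (g x)" if "x \<in> S" for c x
          using c[of c] g(2)[OF that] by auto
        show "norm (of_real (g x) :: 'k) \<le> p x" if "x \<in> S" for x
          using g(3)[OF that] g(3)[of "smul (- 1) x"] g(2)[OF that, of "- 1"] hom[OF that, of "- 1"] subspace_neg[OF S that]
          by simp
        show "p z \<le> norm (of_real (g z) :: 'k)" using g(4) by simp
      qed
    next
      case False
      then obtain i :: 'k where i: "i * i = - 1" and iall: "\<And>c. \<exists>a b. c = a *\<^sub>R 1 + b *\<^sub>R i"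
        using real_or_complex by blast
      have c: "\<exists>a b. c = of_real a + of_real b * i" for c :: 'k
        using iall[of c] by (simp add: scaleR_conv_of_real)
      define f where "f x = of_real (g x) + of_real (- g (smul i x)) * i" for x
      have add: "f (x + y) = f x + f y" if "x \<in> S" "y \<in> S" for x y
        unfolding f_def using that by (simp add: g(1) S_simps scale_right_distrib algebra_simps)
      have scl: "f (smul c x) = c * f x" if x: "x \<in> S" for c x
      proof -
        obtain a b where ab: "c = of_real a + of_real b * i" using c by blast
        have "smul c x = ?r a x + ?r b (smul i x)"
          by (simp add: ab scale_left_distrib)
        then have 1: "g (smul c x) = a * g x + b * g (smul i x)"
          using x by (simp only: g(1) g(2) S_simps)
        have "i * c = of_real a * i + of_real (- b)"
          by (simp add: ab distrib_left mult.left_commute[of i] i)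
        then have "smul i (smul c x) = ?r a (smul i x) + ?r (- b) x"
          by (simp add: scale_left_distrib scale_left_diff_distrib)
        then have 2: "g (smul i (smul c x)) = a * g (smul i x) - b * g x"
          using x by (simp only: g(1) g(2) S_simps)
        have "c * f x = of_real (a * g x) + of_real (b * g x - a * g (smul i x)) * i
            - of_real (b * g (smul i x)) * (i * i)"
          unfolding f_def ab by (simp add: algebra_simps)
        also have "\<dots> = f (smul c x)" unfolding f_def 1 2 i by (simp add: algebra_simps)
        finally show ?thesis by simp
      qed
      have le: "norm (f x) \<le> p x" if x: "x \<in> S" for x
      proof (cases "f x = 0")
        case True
        have "p (x + smul (- 1) x) \<le> p x + p (smul (- 1) x)" by (intro sub S_simps x)
        then show ?thesis using True hom[OF x, of "- 1"] hom[OF x, of 0] by simp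
      next
        case False
        \<comment> \<open>The scalar of modulus \<open>1\<close> that rotates \<open>f x\<close> to \<open>norm (f x)\<close>.\<close>
        define e where "e = of_real (norm (f x)) / f x"
        have ne: "norm e = 1" using False by (simp add: e_def norm_divide)
        have "f (smul e x) = of_real (norm (f x))" using False by (simp add: scl[OF x] e_def)
        then have "of_real (g (smul e x) - norm (f x)) + of_real (- g (smul i (smul e x))) * i = 0"
          by (simp add: f_def[of "smul e x"] diff_eq_eq add.commute)
        then have "\<bar>g (smul e x) - norm (f x)\<bar> \<le> norm (0::'k)"
          using abs_real_part_le_norm[OF i, of "g (smul e x) - norm (f x)" "- g (smul i (smul e x))"]
          by (simp only:)
        then have "norm (f x) = g (smul e x)" by simp
        also have "\<dots> \<le> p (smul e x)" by (intro g S_simps x)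
        also have "\<dots> = p x" using hom[OF x] ne by simp
        finally show ?thesis .
      qed
      have "p z \<le> norm (f z)"
        using abs_real_part_le_norm[OF i, of "g z" "- g (smul i z)"] g(4) by (simp add: f_def)
      with add scl le show thesis by (rule that)
    qed
  qed
qed

end

section \<open>Normed spaces and bounded inclusions\<close>

definition bounded_inclusion :: "'a nspace \<Rightarrow> 'a nspace \<Rightarrow> bool" where
  "bounded_inclusion E F \<longleftrightarrow>
     carr E \<subseteq> carr F \<and> (\<exists>C. \<forall>x\<in>carr E. nrm F x \<le> C * nrm E x)"

context rc_vector_space
begin

lemma subspace_carr: "normed_space smul E \<Longrightarrow> subspace (carr E)"
  by (simp add: normed_space_def)

lemma nrm_nonneg: "normed_space smul E \<Longrightarrow> 0 \<le> nrm E x"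
  unfolding normed_space_def by (cases "x \<in> carr E") auto

lemma nrm_eq_0: "normed_space smul E \<Longrightarrow> x \<in> carr E \<Longrightarrow> nrm E x = 0 \<longleftrightarrow> x = 0"
  by (simp add: normed_space_def)

lemma nrm_0: "normed_space smul E \<Longrightarrow> nrm E 0 = 0"
  using nrm_eq_0 subspace_carr subspace_0 by blast

lemma nrm_triangle:
  "normed_space smul E \<Longrightarrow> x \<in> carr E \<Longrightarrow> y \<in> carr E \<Longrightarrow> nrm E (x + y) \<le> nrm E x + nrm E y"
  by (simp add: normed_space_def)

lemma nrm_smul:
  "normed_space smul E \<Longrightarrow> x \<in> carr E \<Longrightarrow> nrm E (smul c x) = norm c * nrm E x"
  by (simp add: normed_space_def)

lemma nrm_minus_commute:
  assumes E: "normed_space smul E"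
  shows "nrm E (x - y) = nrm E (y - x)"
proof -
  interpret Metric_space "carr E" "ndist E" by (rule Metric_space_ndist[OF vector_space_axioms E])
  show ?thesis using commute[of x y] by (simp add: ndist_def)
qed

lemma nrm_triangle_diff:
  assumes "normed_space smul E" "x \<in> carr E" "y \<in> carr E" "z \<in> carr E"
  shows "nrm E (x - z) \<le> nrm E (x - y) + nrm E (y - z)"
  using nrm_triangle[of E "x - y" "y - z"] assms subspace_diff[OF subspace_carr] by simp

lemma bounded_inclusionE:
  assumes "bounded_inclusion E F" "normed_space smul E"
  obtains C where "C > 0" "\<And>x. x \<in> carr E \<Longrightarrow> nrm F x \<le> C * nrm E x"
proof -
  obtain C where C: "\<And>x. x \<in> carr E \<Longrightarrow> nrm F x \<le> C * nrm E x"
    using assms(1) unfolding bounded_inclusion_def by blast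
  have "nrm F x \<le> max C 1 * nrm E x" if "x \<in> carr E" for x
    using C[OF that] mult_right_mono[of C "max C 1" "nrm E x"] nrm_nonneg[OF assms(2)] by fastforce
  then show ?thesis using that[of "max C 1"] by simp
qed

lemma bounded_inclusion_trans:
  assumes EF: "bounded_inclusion E F" and FG: "bounded_inclusion F G"
    and E: "normed_space smul E" and F: "normed_space smul F"
  shows "bounded_inclusion E G"
proof -
  obtain C where C: "C > 0" "\<And>x. x \<in> carr E \<Longrightarrow> nrm F x \<le> C * nrm E x"
    using bounded_inclusionE[OF EF E] by blast
  obtain D where D: "D > 0" "\<And>x. x \<in> carr F \<Longrightarrow> nrm G x \<le> D * nrm F x"
    using bounded_inclusionE[OF FG F] by blast
  have sub: "carr E \<subseteq> carr F" "carr F \<subseteq> carr G"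
    using EF FG by (auto simp: bounded_inclusion_def)
  have "nrm G x \<le> (D * C) * nrm E x" if "x \<in> carr E" for x
  proof -
    have "nrm G x \<le> D * nrm F x" using D(2) sub that by blast
    also have "\<dots> \<le> D * (C * nrm E x)" using C(2)[OF that] D(1) by simp
    finally show ?thesis by (simp add: mult.assoc)
  qed
  then show ?thesis using sub unfolding bounded_inclusion_def by blast
qed

lemma space_equiv_if_bounded_inclusions:
  assumes EF: "bounded_inclusion E F" and FE: "bounded_inclusion F E"
    and E: "normed_space smul E" and F: "normed_space smul F"
  shows "space_equiv E F"
proof -
  obtain C where C: "C > 0" "\<And>x. x \<in> carr E \<Longrightarrow> nrm F x \<le> C * nrm E x"
    using bounded_inclusionE[OF EF E] by blast
  obtain D where D: "D > 0" "\<And>x. x \<in> carr F \<Longrightarrow> nrm E x \<le> D * nrm F x"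
    using bounded_inclusionE[OF FE F] by blast
  have eq: "carr E = carr F" using EF FE by (auto simp: bounded_inclusion_def)
  have "(1/D) * nrm E x \<le> nrm F x \<and> nrm F x \<le> C * nrm E x" if "x \<in> carr E" for x
    using C D that eq by (simp add: field_simps)
  then show ?thesis unfolding space_equiv_def using eq C(1) D(1) by (metis zero_less_divide_1_iff)
qed

lemma embedded_iff_bounded_inclusion:
  assumes E: "normed_space smul E" and F: "normed_space smul F"
  shows "embedded E F \<longleftrightarrow> bounded_inclusion E F"
proof -
  interpret ME: Metric_space "carr E" "ndist E" by (rule Metric_space_ndist[OF vector_space_axioms E])
  note cont = ME.metric_continuous_map[OF Metric_space_ndist[OF vector_space_axioms F], of "\<lambda>x. x"]
  note sE = subspace_carr[OF E] and sF = subspace_carr[OF F]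
  show ?thesis
  proof
    assume "embedded E F"
    then have sub: "carr E \<subseteq> carr F"
      and c: "\<And>a e. a \<in> carr E \<Longrightarrow> e > 0 \<Longrightarrow> \<exists>d>0. \<forall>x. x \<in> carr E \<and> ndist E a x < d \<longrightarrow> ndist F a x < e"
      unfolding embedded_def ntopology_def cont by blast+
    obtain d where d: "d > 0" "\<And>x. x \<in> carr E \<Longrightarrow> nrm E (0 - x) < d \<Longrightarrow> nrm F (0 - x) < 1"
      using c[OF subspace_0[OF sE], of 1] by (auto simp: ndist_def)
    have "nrm F x \<le> (2 / d) * nrm E x" if x: "x \<in> carr E" for x
    proof (cases "x = 0")
      case True then show ?thesis by (simp add: nrm_0 E F)
    next
      case False
      then have pos: "nrm E x > 0" using nrm_eq_0[OF E x] nrm_nonneg[OF E, of x] by simp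
      let ?c = "of_real (d / (2 * nrm E x)) :: 'k"
      have cx: "smul ?c x \<in> carr E" using x sE by (simp add: subspace_scale)
      have n: "norm ?c = d / (2 * nrm E x)" using pos d(1) by (simp only: norm_of_real) simp
      have "nrm E (smul ?c x) = d / 2" unfolding nrm_smul[OF E x] n using pos by simp
      then have "nrm F (smul ?c x) < 1"
        using d(2)[OF cx] d(1) nrm_minus_commute[OF E, of 0 "smul ?c x"]
          nrm_minus_commute[OF F, of 0 "smul ?c x"] by simp
      moreover have "nrm F (smul ?c x) = d / (2 * nrm E x) * nrm F x"
        using nrm_smul[OF F] sub x n by (metis subsetD)
      ultimately have "d / (2 * nrm E x) * nrm F x < 1" by linarith
      then show ?thesis using pos d(1) by (simp add: field_simps)
    qed
    then show "bounded_inclusion E F" using sub unfolding bounded_inclusion_def by blast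
  next
    assume EF: "bounded_inclusion E F"
    then have sub: "carr E \<subseteq> carr F" by (simp add: bounded_inclusion_def)
    obtain C where C: "C > 0" "\<And>x. x \<in> carr E \<Longrightarrow> nrm F x \<le> C * nrm E x"
      using bounded_inclusionE[OF EF E] by blast
    have "\<exists>d>0. \<forall>x. x \<in> carr E \<and> ndist E a x < d \<longrightarrow> ndist F a x < e"
      if a: "a \<in> carr E" and e: "e > 0" for a e
    proof (intro exI conjI allI impI)
      show "e / C > 0" using e C by simp
      fix x assume x: "x \<in> carr E \<and> ndist E a x < e / C"
      then have "nrm F (a - x) \<le> C * nrm E (a - x)" using a sE by (intro C) (simp add: subspace_diff)
      also have "\<dots> < e" using x C(1) by (simp add: ndist_def field_simps)
      finally show "ndist F a x < e" by (simp add: ndist_def)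
    qed
    then show "embedded E F" unfolding embedded_def ntopology_def cont using sub by auto
  qed
qed

lemma banach_normed: "banach_space smul E \<Longrightarrow> normed_space smul E"
  by (simp add: banach_space_def)

lemma banach_Cauchy_convergent:
  assumes E: "banach_space smul E" and a: "\<And>n::nat. a n \<in> carr E"
    and Cauchy: "\<And>e. e > 0 \<Longrightarrow> \<exists>N. \<forall>m\<ge>N. \<forall>n\<ge>N. nrm E (a m - a n) < e"
  obtains x where "x \<in> carr E" "(\<lambda>n. nrm E (a n - x)) \<longlonglongrightarrow> 0"
proof -
  interpret Metric_space "carr E" "ndist E" by (rule Metric_space_ndist[OF vector_space_axioms banach_normed[OF E]])
  have "MCauchy a" unfolding MCauchy_def ndist_def using a Cauchy by blast
  then obtain x where "limitin mtopology a x sequentially"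
    using E unfolding banach_space_def mcomplete_def by blast
  then have "x \<in> carr E \<and> (\<lambda>n. nrm E (a n - x)) \<longlonglongrightarrow> 0"
    by (simp add: limitin_metric_dist_null ndist_def)
  then show ?thesis using that by blast
qed

text \<open>A sequence with a limit \<open>x\<close> in \<open>E\<close> that is Cauchy in the Banach space \<open>F\<close> has the same limit in \<open>F\<close>,
  because both limits are limits in the normed space \<open>G\<close>.  Both inclusion criteria that follow are
  obtained from this.\<close>

lemma limit_in_banach_space:
  assumes E: "normed_space smul E" and F: "banach_space smul F" and G: "normed_space smul G"
    and EG: "bounded_inclusion E G" and FG: "bounded_inclusion F G"
    and x: "x \<in> carr E" and aE: "\<And>n::nat. a n \<in> carr E" and aF: "\<And>n. a n \<in> carr F"
    and lim: "(\<lambda>n. nrm E (x - a n)) \<longlonglongrightarrow> 0"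
    and Cauchy: "\<And>e. e > 0 \<Longrightarrow> \<exists>N. \<forall>m\<ge>N. \<forall>n\<ge>N. nrm F (a m - a n) < e"
    and bound: "\<And>n. nrm F (a n) \<le> B n" and B: "B \<longlonglongrightarrow> b"
  shows "x \<in> carr F" "nrm F x \<le> b"
proof -
  note F' = banach_normed[OF F]
  note sE = subspace_carr[OF E] and sF = subspace_carr[OF F'] and sG = subspace_carr[OF G]
  obtain CE where CE: "CE > 0" "\<And>x. x \<in> carr E \<Longrightarrow> nrm G x \<le> CE * nrm E x"
    using bounded_inclusionE[OF EG E] by blast
  obtain CF where CF: "CF > 0" "\<And>x. x \<in> carr F \<Longrightarrow> nrm G x \<le> CF * nrm F x"
    using bounded_inclusionE[OF FG F'] by blast
  obtain y where y: "y \<in> carr F" "(\<lambda>n. nrm F (a n - y)) \<longlonglongrightarrow> 0"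
    by (rule banach_Cauchy_convergent[OF F, of a]) (use aF Cauchy in blast)+
  have xG: "x \<in> carr G" and yG: "y \<in> carr G" and aG: "\<And>n. a n \<in> carr G"
    using EG FG x y(1) aE unfolding bounded_inclusion_def by blast+
  have "nrm G (x - y) \<le> CE * nrm E (x - a n) + CF * nrm F (a n - y)" for n
    using nrm_triangle_diff[OF G xG aG[of n] yG]
      CE(2)[OF subspace_diff[OF sE x aE[of n]]] CF(2)[OF subspace_diff[OF sF aF[of n] y(1)]] by linarith
  moreover have "(\<lambda>n. CE * nrm E (x - a n) + CF * nrm F (a n - y)) \<longlonglongrightarrow> CE * 0 + CF * 0"
    by (intro tendsto_intros lim y)
  ultimately have "nrm G (x - y) \<le> 0"
    by (intro LIMSEQ_le_const[of _ "CE * 0 + CF * 0" "nrm G (x - y)", simplified]) auto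
  then have "x = y"
    using nrm_eq_0[OF G subspace_diff[OF sG xG yG]] nrm_nonneg[OF G, of "x - y"] by simp
  have "nrm F y \<le> B n + nrm F (a n - y)" for n
    using nrm_triangle[OF F' aF[of n] subspace_diff[OF sF y(1) aF[of n]]] bound[of n]
      nrm_minus_commute[OF F', of y "a n"] by simp
  moreover have "(\<lambda>n. B n + nrm F (a n - y)) \<longlonglongrightarrow> b + 0"
    by (intro tendsto_intros B y)
  ultimately have "nrm F y \<le> b"
    by (intro LIMSEQ_le_const[of _ "b + 0" "nrm F y", simplified]) auto
  then show "x \<in> carr F" "nrm F x \<le> b" using \<open>x = y\<close> y(1) by simp_all
qed

lemma bounded_inclusion_from_dense:
  assumes E: "normed_space smul E" and F: "banach_space smul F" and G: "normed_space smul G"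
    and EG: "bounded_inclusion E G" and FG: "bounded_inclusion F G"
    and D: "subspace D" "D \<subseteq> carr E" "D \<subseteq> carr F"
    and dense: "\<And>x e. x \<in> carr E \<Longrightarrow> e > 0 \<Longrightarrow> \<exists>a\<in>D. nrm E (x - a) < e"
    and bound: "\<And>a. a \<in> D \<Longrightarrow> nrm F a \<le> C * nrm E a"
  shows "bounded_inclusion E F"
proof -
  note sE = subspace_carr[OF E]
  define C' where "C' = max C 1"
  have C': "C' > 0" "C \<le> C'" by (auto simp: C'_def)
  have bound': "nrm F a \<le> C' * nrm E a" if "a \<in> D" for a
    using bound[OF that] mult_right_mono[OF C'(2) nrm_nonneg[OF E, of a]] by linarith
  have "x \<in> carr F \<and> nrm F x \<le> C' * nrm E x" if x: "x \<in> carr E" for x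
  proof -
    have "\<forall>n. \<exists>a\<in>D. nrm E (x - a) < inverse (real (Suc n))" using dense[OF x] by simp
    then obtain a where a: "\<And>n. a n \<in> D" "\<And>n. nrm E (x - a n) < inverse (real (Suc n))"
      by metis
    have aE: "a n \<in> carr E" and aF: "a n \<in> carr F" for n using a(1) D by auto
    have aD: "a m - a n \<in> D" for m n using a(1) D(1) by (simp add: subspace_diff)
    have lim: "(\<lambda>n. nrm E (x - a n)) \<longlonglongrightarrow> 0"
    proof (rule tendsto_sandwich[OF _ _ tendsto_const LIMSEQ_inverse_real_of_nat])
      show "\<forall>\<^sub>F n in sequentially. 0 \<le> nrm E (x - a n)" by (simp add: nrm_nonneg[OF E])
      show "\<forall>\<^sub>F n in sequentially. nrm E (x - a n) \<le> inverse (real (Suc n))"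
        using a(2) by (simp add: less_imp_le)
    qed
    have Cauchy: "\<exists>N. \<forall>m\<ge>N. \<forall>n\<ge>N. nrm F (a m - a n) < e" if e: "e > 0" for e
    proof -
      have "e / (2 * C') > 0" using e C' by simp
      then obtain N where N: "\<And>n. n \<ge> N \<Longrightarrow> nrm E (x - a n) < e / (2 * C')"
        using order_tendstoD(2)[OF lim] unfolding eventually_sequentially by blast
      have "nrm F (a m - a n) < e" if "m \<ge> N" "n \<ge> N" for m n
      proof -
        have "nrm F (a m - a n) \<le> C' * nrm E (a m - a n)" by (rule bound'[OF aD])
        also have "\<dots> \<le> C' * (nrm E (x - a m) + nrm E (x - a n))"
          using nrm_triangle_diff[OF E aE[of m] x aE[of n]] nrm_minus_commute[OF E, of "a m" x] C'
          by (simp add: mult_left_mono)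
        also have "\<dots> < C' * (e / (2 * C') + e / (2 * C'))"
          using N[OF that(1)] N[OF that(2)] C' by (intro mult_strict_left_mono) auto
        also have "\<dots> = e" using C' by (simp add: field_simps)
        finally show ?thesis .
      qed
      then show ?thesis by blast
    qed
    have bnd: "nrm F (a n) \<le> C' * (nrm E x + nrm E (x - a n))" for n
    proof -
      have "nrm E (a n) \<le> nrm E x + nrm E (x - a n)"
        using nrm_triangle[OF E x subspace_diff[OF sE aE[of n] x]]
          nrm_minus_commute[OF E, of x "a n"] by simp
      then have "C' * nrm E (a n) \<le> C' * (nrm E x + nrm E (x - a n))" using C' by simp
      then show ?thesis using bound'[OF a(1)[of n]] by linarith
    qed
    have "(\<lambda>n. C' * (nrm E x + nrm E (x - a n))) \<longlonglongrightarrow> C' * (nrm E x + 0)"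
      by (intro tendsto_intros lim)
    from limit_in_banach_space[OF E F G EG FG x aE aF lim Cauchy bnd this] show ?thesis by simp
  qed
  then show ?thesis unfolding bounded_inclusion_def by blast
qed

text \<open>Approximating \<open>x\<close> by some \<open>y \<in> F\<close>, then the error \<open>x - y\<close> in the same way, and so on, the errors decay
  geometrically in \<open>E\<close> and the approximants form a geometric series in \<open>F\<close>.\<close>

lemma bounded_inclusion_from_approximation:
  assumes E: "normed_space smul E" and F: "banach_space smul F" and G: "normed_space smul G"
    and EG: "bounded_inclusion E G" and FG: "bounded_inclusion F G"
    and q: "0 \<le> q" "q < 1"
    and approx: "\<And>x. x \<in> carr E \<Longrightarrow>
      \<exists>y\<in>carr E \<inter> carr F. nrm E (x - y) \<le> q * nrm E x \<and> nrm F y \<le> M * nrm E x"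
  shows "bounded_inclusion E F"
proof -
  note F' = banach_normed[OF F]
  note sE = subspace_carr[OF E] and sF = subspace_carr[OF F']
  have "\<forall>x\<in>carr E. \<exists>y. y \<in> carr E \<and> y \<in> carr F \<and>
      nrm E (x - y) \<le> q * nrm E x \<and> nrm F y \<le> M * nrm E x"
    using approx by blast
  then obtain h where h: "\<And>x. x \<in> carr E \<Longrightarrow> h x \<in> carr E" "\<And>x. x \<in> carr E \<Longrightarrow> h x \<in> carr F"
      "\<And>x. x \<in> carr E \<Longrightarrow> nrm E (x - h x) \<le> q * nrm E x"
      "\<And>x. x \<in> carr E \<Longrightarrow> nrm F (h x) \<le> M * nrm E x"
    by metis
  have "x \<in> carr F \<and> nrm F x \<le> (max M 0 / (1 - q)) * nrm E x" if x: "x \<in> carr E" for x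
  proof -
    \<comment> \<open>The partial sums of the successive approximants.\<close>
    define a where "a = rec_nat 0 (\<lambda>_ b. b + h (x - b))"
    have a0: "a 0 = 0" and aS: "\<And>n. a (Suc n) = a n + h (x - a n)" by (simp_all add: a_def)
    \<comment> \<open>The sum of the geometric series that majorizes the norms of the increments in \<open>F\<close>.\<close>
    define K where "K = max M 0 * nrm E x / (1 - q)"
    have aE: "a n \<in> carr E" for n
      by (induction n) (use x sE h in \<open>simp_all add: a0 aS subspace_0 subspace_add subspace_diff\<close>)
    have rE: "x - a n \<in> carr E" for n using x aE sE by (simp add: subspace_diff)
    have aF: "a n \<in> carr F" for n
      by (induction n) (use sF h(2) rE in \<open>simp_all add: a0 aS subspace_0 subspace_add\<close>)
    have r: "nrm E (x - a n) \<le> q ^ n * nrm E x" for n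
    proof (induction n)
      case 0 then show ?case by (simp add: a0)
    next
      case (Suc n)
      have "nrm E (x - a (Suc n)) = nrm E ((x - a n) - h (x - a n))" by (simp add: aS algebra_simps)
      also have "\<dots> \<le> q * nrm E (x - a n)" by (rule h(3)[OF rE])
      also have "\<dots> \<le> q * (q ^ n * nrm E x)" using Suc q by (simp add: mult_left_mono)
      finally show ?case by simp
    qed
    have step: "nrm F (a (Suc n) - a n) \<le> K * (q ^ n - q ^ Suc n)" for n
    proof -
      have "nrm F (a (Suc n) - a n) \<le> M * nrm E (x - a n)" using h(4)[OF rE] by (simp add: aS)
      also have "\<dots> \<le> max M 0 * nrm E (x - a n)" by (intro mult_right_mono nrm_nonneg[OF E]) simp
      also have "\<dots> \<le> max M 0 * (q ^ n * nrm E x)" by (intro mult_left_mono r) simp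
      also have "\<dots> = K * (q ^ n - q ^ Suc n)" using q by (simp add: K_def field_simps)
      finally show ?thesis .
    qed
    have tail: "nrm F (a (n + j) - a n) \<le> K * (q ^ n - q ^ (n + j))" for n j
    proof (induction j)
      case 0 then show ?case by (simp add: nrm_0[OF F'])
    next
      case (Suc j)
      then show ?case
        using nrm_triangle_diff[OF F' aF[of "n + Suc j"] aF[of "n + j"] aF[of n]] step[of "n + j"]
        by (simp add: right_diff_distrib)
    qed
    have K: "K \<ge> 0" using q nrm_nonneg[OF E] by (simp add: K_def)
    have tail': "nrm F (a m - a n) \<le> K * q ^ n" if "n \<le> m" for m n
    proof -
      have "K * (q ^ n - q ^ m) \<le> K * q ^ n" using K q by (intro mult_left_mono) auto
      then show ?thesis using tail[of n "m - n"] that by simp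
    qed
    have q0: "(\<lambda>n. q ^ n) \<longlonglongrightarrow> 0" using q by (intro LIMSEQ_realpow_zero) auto
    have qx: "(\<lambda>n. q ^ n * nrm E x) \<longlonglongrightarrow> 0" by (rule tendsto_mult_left_zero[OF q0])
    have lim: "(\<lambda>n. nrm E (x - a n)) \<longlonglongrightarrow> 0"
    proof (rule tendsto_sandwich[OF _ _ tendsto_const qx])
      show "\<forall>\<^sub>F n in sequentially. 0 \<le> nrm E (x - a n)" by (simp add: nrm_nonneg[OF E])
      show "\<forall>\<^sub>F n in sequentially. nrm E (x - a n) \<le> q ^ n * nrm E x" by (simp add: r)
    qed
    have Cauchy: "\<exists>N. \<forall>m\<ge>N. \<forall>n\<ge>N. nrm F (a m - a n) < e" if e: "e > 0" for e
    proof -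
      have "(\<lambda>n. K * q ^ n) \<longlonglongrightarrow> 0" by (rule tendsto_mult_right_zero[OF q0])
      from order_tendstoD(2)[OF this e] obtain N where N: "\<And>n. n \<ge> N \<Longrightarrow> K * q ^ n < e"
        unfolding eventually_sequentially by blast
      have "nrm F (a m - a n) < e" if "N \<le> m" "N \<le> n" for m n
      proof (cases "n \<le> m")
        case True
        then show ?thesis using tail'[OF True] N[OF that(2)] by linarith
      next
        case False
        then show ?thesis
          using tail'[of m n] N[OF that(1)] nrm_minus_commute[OF F', of "a m" "a n"] by linarith
      qed
      then show ?thesis by blast
    qed
    have bnd: "nrm F (a n) \<le> K" for n using tail'[of 0 n] by (simp add: a0)
    from limit_in_banach_space[OF E F G EG FG x aE aF lim Cauchy bnd tendsto_const]
    show ?thesis by (simp add: K_def)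
  qed
  then show ?thesis unfolding bounded_inclusion_def by blast
qed

end

section \<open>The K-functional and the sum of a couple\<close>

text \<open>Peetre's K-functional.  The value \<open>s = 0\<close> is used as well: on \<open>X\<close> it is the distance to
  \<open>X \<inter> Y\<close>.\<close>

definition K_functional :: "'a::ab_group_add nspace \<Rightarrow> 'a nspace \<Rightarrow> real \<Rightarrow> 'a \<Rightarrow> real" where
  "K_functional X Y s z = Inf {nrm X x + s * nrm Y y | x y. x \<in> carr X \<and> y \<in> carr Y \<and> z = x + y}"

context rc_vector_space
begin

lemma subspace_sum_carr:
  "normed_space smul X \<Longrightarrow> normed_space smul Y \<Longrightarrow> subspace (sum_carr X Y)"
  unfolding sum_carr_def by (intro subspace_sums subspace_carr)

lemma carr_subset_sum_carr:
  assumes "normed_space smul X" "normed_space smul Y"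
  shows "carr X \<subseteq> sum_carr X Y" "carr Y \<subseteq> sum_carr X Y"
proof -
  note 0 = subspace_0[OF subspace_carr[OF assms(1)]] subspace_0[OF subspace_carr[OF assms(2)]]
  show "carr X \<subseteq> sum_carr X Y"
  proof
    fix x assume "x \<in> carr X"
    then show "x \<in> sum_carr X Y" unfolding sum_carr_def using 0 by (intro CollectI exI[of _ x] exI[of _ 0]) simp
  qed
  show "carr Y \<subseteq> sum_carr X Y"
  proof
    fix y assume "y \<in> carr Y"
    then show "y \<in> sum_carr X Y" unfolding sum_carr_def using 0 by (intro CollectI exI[of _ 0] exI[of _ y]) simp
  qed
qed

lemma K_functional_le:
  assumes "normed_space smul X" "normed_space smul Y" "0 \<le> s" "x \<in> carr X" "y \<in> carr Y"
  shows "K_functional X Y s (x + y) \<le> nrm X x + s * nrm Y y"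
  unfolding K_functional_def
proof (rule cInf_lower)
  show "nrm X x + s * nrm Y y \<in> {nrm X x' + s * nrm Y y' | x' y'. x' \<in> carr X \<and> y' \<in> carr Y \<and> x + y = x' + y'}"
    using assms by blast
  show "bdd_below {nrm X x' + s * nrm Y y' | x' y'. x' \<in> carr X \<and> y' \<in> carr Y \<and> x + y = x' + y'}"
    by (rule bdd_belowI[of _ 0]) (use nrm_nonneg[OF assms(1)] nrm_nonneg[OF assms(2)] assms(3) in auto)
qed

lemma K_functional_greatest:
  assumes "z \<in> sum_carr X Y"
    and "\<And>x y. x \<in> carr X \<Longrightarrow> y \<in> carr Y \<Longrightarrow> z = x + y \<Longrightarrow> r \<le> nrm X x + s * nrm Y y"
  shows "r \<le> K_functional X Y s z"
  unfolding K_functional_def by (rule cInf_greatest) (use assms in \<open>auto simp: sum_carr_def\<close>)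

lemma K_functional_lessE:
  assumes "z \<in> sum_carr X Y" "K_functional X Y s z < r"
  obtains x y where "x \<in> carr X" "y \<in> carr Y" "z = x + y" "nrm X x + s * nrm Y y < r"
  using K_functional_greatest[OF assms(1), of r s] assms(2) by (meson not_le)

lemma K_functional_nonneg:
  assumes "normed_space smul X" "normed_space smul Y" "0 \<le> s" "z \<in> sum_carr X Y"
  shows "0 \<le> K_functional X Y s z"
  by (rule K_functional_greatest[OF assms(4)])
     (use nrm_nonneg[OF assms(1)] nrm_nonneg[OF assms(2)] assms(3) in auto)

lemma K_functional_left:
  assumes "normed_space smul X" "normed_space smul Y" "0 \<le> s" "x \<in> carr X"
  shows "K_functional X Y s x \<le> nrm X x"
  using K_functional_le[OF assms subspace_0[OF subspace_carr[OF assms(2)]]] nrm_0[OF assms(2)] by simp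

lemma K_functional_right:
  assumes "normed_space smul X" "normed_space smul Y" "0 \<le> s" "y \<in> carr Y"
  shows "K_functional X Y s y \<le> s * nrm Y y"
  using K_functional_le[OF assms(1-3) subspace_0[OF subspace_carr[OF assms(1)]] assms(4)] nrm_0[OF assms(1)] by simp

lemma K_functional_mono:
  assumes X: "normed_space smul X" and Y: "normed_space smul Y" and s: "0 \<le> s" "s \<le> t"
    and z: "z \<in> sum_carr X Y"
  shows "K_functional X Y s z \<le> K_functional X Y t z"
proof (rule K_functional_greatest[OF z])
  fix x y assume xy: "x \<in> carr X" "y \<in> carr Y" "z = x + y"
  have "K_functional X Y s z \<le> nrm X x + s * nrm Y y"
    unfolding xy(3) by (rule K_functional_le[OF X Y s(1) xy(1,2)])
  also have "\<dots> \<le> nrm X x + t * nrm Y y" using s nrm_nonneg[OF Y] by (simp add: mult_right_mono)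
  finally show "K_functional X Y s z \<le> nrm X x + t * nrm Y y" .
qed

lemma K_functional_add:
  assumes X: "normed_space smul X" and Y: "normed_space smul Y" and s: "0 \<le> s"
    and z: "z \<in> sum_carr X Y" and w: "w \<in> sum_carr X Y"
  shows "K_functional X Y s (z + w) \<le> K_functional X Y s z + K_functional X Y s w"
proof (rule field_le_epsilon)
  fix e :: real assume e: "e > 0"
  have "K_functional X Y s z < K_functional X Y s z + e / 2" using e by simp
  then obtain x y where xy: "x \<in> carr X" "y \<in> carr Y" "z = x + y"
    "nrm X x + s * nrm Y y < K_functional X Y s z + e / 2" by (rule K_functional_lessE[OF z])
  have "K_functional X Y s w < K_functional X Y s w + e / 2" using e by simp
  then obtain x' y' where xy': "x' \<in> carr X" "y' \<in> carr Y" "w = x' + y'"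
    "nrm X x' + s * nrm Y y' < K_functional X Y s w + e / 2" by (rule K_functional_lessE[OF w])
  have "z + w = (x + x') + (y + y')" using xy xy' by simp
  then have "K_functional X Y s (z + w) \<le> nrm X (x + x') + s * nrm Y (y + y')"
    using xy xy' subspace_add[OF subspace_carr[OF X]] subspace_add[OF subspace_carr[OF Y]]
    by (simp only:) (intro K_functional_le[OF X Y s])
  also have "\<dots> \<le> (nrm X x + nrm X x') + s * (nrm Y y + nrm Y y')"
    by (intro add_mono mult_left_mono nrm_triangle X Y xy xy' s)
  finally show "K_functional X Y s (z + w) \<le> K_functional X Y s z + K_functional X Y s w + e"
    using xy xy' by (simp add: distrib_left)
qed

lemma K_functional_smul_le:
  assumes X: "normed_space smul X" and Y: "normed_space smul Y" and s: "0 \<le> s"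
    and z: "z \<in> sum_carr X Y"
  shows "K_functional X Y s (smul c z) \<le> norm c * K_functional X Y s z"
proof (cases "c = 0")
  case True
  then show ?thesis using K_functional_left[OF X Y s subspace_0[OF subspace_carr[OF X]]] nrm_0[OF X] by simp
next
  case False
  have "K_functional X Y s (smul c z) / norm c \<le> K_functional X Y s z"
  proof (rule K_functional_greatest[OF z])
    fix x y assume xy: "x \<in> carr X" "y \<in> carr Y" "z = x + y"
    have "K_functional X Y s (smul c x + smul c y) \<le> nrm X (smul c x) + s * nrm Y (smul c y)"
      using xy subspace_scale[OF subspace_carr[OF X]] subspace_scale[OF subspace_carr[OF Y]]
      by (intro K_functional_le[OF X Y s])
    also have "\<dots> = norm c * (nrm X x + s * nrm Y y)"
      using xy by (simp add: nrm_smul X Y algebra_simps)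
    finally show "K_functional X Y s (smul c z) / norm c \<le> nrm X x + s * nrm Y y"
      using False xy by (simp add: scale_right_distrib field_simps)
  qed
  then show ?thesis using False by (simp add: field_simps)
qed

lemma K_functional_smul:
  assumes X: "normed_space smul X" and Y: "normed_space smul Y" and s: "0 \<le> s"
    and z: "z \<in> sum_carr X Y"
  shows "K_functional X Y s (smul c z) = norm c * K_functional X Y s z"
proof (cases "c = 0")
  case True
  then show ?thesis
    using K_functional_smul_le[OF assms, of 0] subspace_0[OF subspace_sum_carr[OF X Y]] K_functional_nonneg[OF X Y s]
    by (simp add: order_antisym)
next
  case False
  have cz: "smul c z \<in> sum_carr X Y" using z subspace_scale[OF subspace_sum_carr[OF X Y]] by blast
  have "K_functional X Y s z \<le> norm (inverse c) * K_functional X Y s (smul c z)"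
    using K_functional_smul_le[OF X Y s cz, of "inverse c"] False by simp
  then have "norm c * K_functional X Y s z \<le> K_functional X Y s (smul c z)"
    using False by (simp add: norm_divide field_simps)
  then show ?thesis using K_functional_smul_le[OF assms, of c] by simp
qed

lemma carr_sum_space [simp]: "carr (sum_space X Y) = sum_carr X Y"
  by (simp add: sum_space_def)

lemma nrm_sum_space:
  "nrm (sum_space X Y) z = (if z \<in> sum_carr X Y then K_functional X Y 1 z else 0)"
  by (simp add: sum_space_def K_functional_def)

lemma banach_coupleD:
  assumes "banach_couple smul X Y"
  shows "banach_space smul X" "banach_space smul Y" "normed_space smul X" "normed_space smul Y"
  using assms by (auto simp: banach_couple_def banach_space_def)

lemma limitin_ambient:
  assumes E: "normed_space smul E" and cont: "continuous_map (ntopology E) \<T> (\<lambda>x. x)"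
    and a: "\<And>n::nat. a n \<in> carr E" and lim: "(\<lambda>n. nrm E (a n)) \<longlonglongrightarrow> 0"
  shows "limitin \<T> a 0 sequentially"
proof -
  interpret Metric_space "carr E" "ndist E" by (rule Metric_space_ndist[OF vector_space_axioms E])
  have "limitin (ntopology E) a 0 sequentially"
    unfolding ntopology_def limitin_metric_dist_null
    using a lim subspace_0[OF subspace_carr[OF E]] by (simp add: ndist_def)
  from continuous_map_limit[OF cont this] show ?thesis by (simp add: o_def)
qed

text \<open>This is where the common Hausdorff vector topology enters: it makes the seminorm of the sum
  space a norm.\<close>

lemma null_decomposition_eq_0:
  assumes XY: "banach_couple smul X Y"
    and x: "\<And>n::nat. x n \<in> carr X" "(\<lambda>n. nrm X (x n)) \<longlonglongrightarrow> 0"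
    and y: "\<And>n. y n \<in> carr Y" "(\<lambda>n. nrm Y (y n)) \<longlonglongrightarrow> 0"
    and z: "\<And>n. z = x n + y n"
  shows "z = 0"
proof -
  obtain \<T> where T: "topspace \<T> = UNIV" "Hausdorff_space \<T>"
    "continuous_map (prod_topology \<T> \<T>) \<T> (\<lambda>(x, y). x + y)"
    "continuous_map (ntopology X) \<T> (\<lambda>x. x)" "continuous_map (ntopology Y) \<T> (\<lambda>y. y)"
    using XY unfolding banach_couple_def hausdorff_vector_topology_def by blast
  have "limitin (prod_topology \<T> \<T>) (\<lambda>n. (x n, y n)) (0, 0) sequentially"
    unfolding limitin_pairwise o_def
    using limitin_ambient[OF banach_coupleD(3)[OF XY] T(4) x] limitin_ambient[OF banach_coupleD(4)[OF XY] T(5) y]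
    by simp
  from continuous_map_limit[OF T(3) this]
  have "limitin \<T> (\<lambda>n. z) 0 sequentially" using z by (simp add: o_def)
  moreover have "limitin \<T> (\<lambda>n. z) z sequentially" using T(1) by simp
  ultimately show ?thesis using T(2) limitin_Hausdorff_unique trivial_limit_sequentially by metis
qed

lemma normed_space_sum:
  assumes XY: "banach_couple smul X Y"
  shows "normed_space smul (sum_space X Y)"
proof -
  note X = banach_coupleD(3)[OF XY] and Y = banach_coupleD(4)[OF XY]
  note S = subspace_sum_carr[OF X Y]
  have "z = 0" if z: "z \<in> sum_carr X Y" and K0: "K_functional X Y 1 z = 0" for z
  proof -
    have "\<exists>x y. x \<in> carr X \<and> y \<in> carr Y \<and> z = x + y \<and> nrm X x + nrm Y y < inverse (real (Suc n))" for n
      by (rule K_functional_lessE[OF z, of 1 "inverse (real (Suc n))"]) (use K0 in auto)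
    then obtain x y where xy: "\<And>n. x n \<in> carr X" "\<And>n. y n \<in> carr Y" "\<And>n. z = x n + y n"
      "\<And>n. nrm X (x n) + nrm Y (y n) < inverse (real (Suc n))" by metis
    have xb: "nrm X (x n) \<le> inverse (real (Suc n))" and yb: "nrm Y (y n) \<le> inverse (real (Suc n))" for n
      using xy(4)[of n] nrm_nonneg[OF X, of "x n"] nrm_nonneg[OF Y, of "y n"] by linarith+
    have x0: "(\<lambda>n. nrm X (x n)) \<longlonglongrightarrow> 0"
      by (rule tendsto_sandwich[OF _ _ tendsto_const LIMSEQ_inverse_real_of_nat])
         (simp_all only: nrm_nonneg[OF X] xb eventually_True)
    have y0: "(\<lambda>n. nrm Y (y n)) \<longlonglongrightarrow> 0"
      by (rule tendsto_sandwich[OF _ _ tendsto_const LIMSEQ_inverse_real_of_nat])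
         (simp_all only: nrm_nonneg[OF Y] yb eventually_True)
    show ?thesis by (rule null_decomposition_eq_0[OF XY xy(1) x0 xy(2) y0 xy(3)])
  qed
  moreover have "K_functional X Y 1 0 = 0"
    using K_functional_smul[OF X Y _ subspace_0[OF S], of 1 0] by simp
  ultimately show ?thesis
    unfolding normed_space_def nrm_sum_space carr_sum_space
    using S K_functional_nonneg[OF X Y, of 1] K_functional_add[OF X Y, of 1] K_functional_smul[OF X Y, of 1]
      subspace_add[OF S] subspace_scale[OF S] by auto
qed

lemma normed_space_inter:
  assumes X: "normed_space smul X" and Y: "normed_space smul Y"
  shows "normed_space smul (inter_space X Y)"
proof -
  note sub = subspace_inter[OF subspace_carr[OF X] subspace_carr[OF Y]]
  have "nrm X (x + y) \<le> max (nrm X x) (nrm Y x) + max (nrm X y) (nrm Y y)"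
    if "x \<in> carr X" "y \<in> carr X" for x y
    using nrm_triangle[OF X that] by linarith
  moreover have "nrm Y (x + y) \<le> max (nrm X x) (nrm Y x) + max (nrm X y) (nrm Y y)"
    if "x \<in> carr Y" "y \<in> carr Y" for x y
    using nrm_triangle[OF Y that] by linarith
  moreover have "max (nrm X x) (nrm Y x) = 0 \<longleftrightarrow> x = 0" if "x \<in> carr X" "x \<in> carr Y" for x
    using nrm_eq_0[OF X that(1)] nrm_eq_0[OF Y that(2)] nrm_nonneg[OF X, of x] nrm_nonneg[OF Y, of x]
    by (auto simp: max_def)
  moreover have "max (norm c * nrm X x) (norm c * nrm Y x) = norm c * max (nrm X x) (nrm Y x)" for c :: 'k and x
    by (simp add: max_mult_distrib_left)
  ultimately show ?thesis
    unfolding normed_space_def inter_space_def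
    using sub subspace_add[OF sub] subspace_scale[OF sub] nrm_nonneg[OF X]
      nrm_smul[OF X] nrm_smul[OF Y]
    by (simp add: le_max_iff_disj)
qed

lemma bounded_inclusion_inter:
  assumes "bounded_inclusion E V" "bounded_inclusion E W" "normed_space smul E"
  shows "bounded_inclusion E (inter_space V W)"
proof -
  obtain C where C: "C > 0" "\<And>x. x \<in> carr E \<Longrightarrow> nrm V x \<le> C * nrm E x"
    using bounded_inclusionE[OF assms(1,3)] by blast
  obtain D where D: "D > 0" "\<And>x. x \<in> carr E \<Longrightarrow> nrm W x \<le> D * nrm E x"
    using bounded_inclusionE[OF assms(2,3)] by blast
  have sub: "carr E \<subseteq> carr V" "carr E \<subseteq> carr W" using assms by (auto simp: bounded_inclusion_def)
  have "max (nrm V x) (nrm W x) \<le> max C D * nrm E x" if "x \<in> carr E" for x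
    using C(2)[OF that] D(2)[OF that] mult_right_mono[of C "max C D" "nrm E x"]
      mult_right_mono[of D "max C D" "nrm E x"] nrm_nonneg[OF assms(3), of x] by simp
  then show ?thesis using sub unfolding bounded_inclusion_def inter_space_def by auto
qed

lemma bounded_inclusion_sum:
  assumes VW: "banach_couple smul V W" and F: "normed_space smul F"
    and "bounded_inclusion V F" "bounded_inclusion W F"
  shows "bounded_inclusion (sum_space V W) F"
proof -
  note V = banach_coupleD(3)[OF VW] and W = banach_coupleD(4)[OF VW]
  obtain C where C: "C > 0" "\<And>x. x \<in> carr V \<Longrightarrow> nrm F x \<le> C * nrm V x"
    using bounded_inclusionE[OF assms(3) V] by blast
  obtain D where D: "D > 0" "\<And>x. x \<in> carr W \<Longrightarrow> nrm F x \<le> D * nrm W x"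
    using bounded_inclusionE[OF assms(4) W] by blast
  have sub: "carr V \<subseteq> carr F" "carr W \<subseteq> carr F" using assms by (auto simp: bounded_inclusion_def)
  then have "sum_carr V W \<subseteq> carr F"
    unfolding sum_carr_def using subspace_add[OF subspace_carr[OF F]] by blast
  moreover have "nrm F z \<le> (C + D) * K_functional V W 1 z" if z: "z \<in> sum_carr V W" for z
  proof -
    have "nrm F z / (C + D) \<le> K_functional V W 1 z"
    proof (rule K_functional_greatest[OF z])
      fix x y assume xy: "x \<in> carr V" "y \<in> carr W" "z = x + y"
      then have "nrm F z \<le> nrm F x + nrm F y" using sub nrm_triangle[OF F] by blast
      also have "\<dots> \<le> C * nrm V x + D * nrm W y" using C(2)[OF xy(1)] D(2)[OF xy(2)] by simp
      also have "\<dots> \<le> (C + D) * (nrm V x + 1 * nrm W y)"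
        using C(1) D(1) nrm_nonneg[OF V, of x] nrm_nonneg[OF W, of y] by (simp add: algebra_simps)
      finally show "nrm F z / (C + D) \<le> nrm V x + 1 * nrm W y" using C(1) D(1) by (simp add: field_simps)
    qed
    then show ?thesis using C(1) D(1) by (simp add: field_simps)
  qed
  ultimately show ?thesis
    unfolding bounded_inclusion_def carr_sum_space nrm_sum_space by auto
qed

section \<open>Testing interpolation spaces with operators of rank one\<close>

lemma op_norm_le:
  assumes E: "normed_space smul E" and B: "0 \<le> B" "\<And>x. x \<in> carr E \<Longrightarrow> nrm E (T x) \<le> B * nrm E x"
  shows "op_norm E T \<le> B"
  unfolding op_norm_def
proof (rule cSUP_least)
  show "{x \<in> carr E. nrm E x \<le> 1} \<noteq> {}"
    using subspace_0[OF subspace_carr[OF E]] nrm_0[OF E] by force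
  fix x assume x: "x \<in> {x \<in> carr E. nrm E x \<le> 1}"
  then have "nrm E (T x) \<le> B * nrm E x" using B by simp
  also have "\<dots> \<le> B * 1" using x B by (intro mult_left_mono) auto
  finally show "nrm E (T x) \<le> B" by simp
qed

lemma nrm_le_op_norm:
  assumes E: "normed_space smul E" and T: "maps_boundedly E T"
    and hom: "\<And>c x. x \<in> carr E \<Longrightarrow> T (smul c x) = smul c (T x)" and x: "x \<in> carr E"
  shows "nrm E (T x) \<le> op_norm E T * nrm E x"
proof (cases "x = 0")
  case True
  then show ?thesis using hom[OF x, of 0] by (simp add: nrm_0[OF E])
next
  case False
  obtain B where B: "\<And>x. x \<in> carr E \<Longrightarrow> nrm E (T x) \<le> B * nrm E x"
    using T unfolding maps_boundedly_def by blast
  have pos: "nrm E x > 0" using False nrm_eq_0[OF E x] nrm_nonneg[OF E, of x] by simp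
  let ?u = "smul (of_real (1 / nrm E x)) x"
  have u: "?u \<in> carr E" using x subspace_scale[OF subspace_carr[OF E]] by blast
  have nc: "norm (of_real (1 / nrm E x) :: 'k) = 1 / nrm E x" using pos by (simp only: norm_of_real) simp
  have nu: "nrm E ?u = 1" unfolding nrm_smul[OF E x] nc using pos by simp
  have Tx: "T x \<in> carr E" using T x unfolding maps_boundedly_def by blast
  have "bdd_above ((\<lambda>x. nrm E (T x)) ` {x \<in> carr E. nrm E x \<le> 1})"
  proof (rule bdd_aboveI2)
    fix y assume y: "y \<in> {x \<in> carr E. nrm E x \<le> 1}"
    then have "nrm E (T y) \<le> B * nrm E y" using B by simp
    also have "\<dots> \<le> \<bar>B\<bar> * nrm E y" by (intro mult_right_mono nrm_nonneg[OF E]) simp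
    also have "\<dots> \<le> \<bar>B\<bar> * 1" using y by (intro mult_left_mono) auto
    finally show "nrm E (T y) \<le> \<bar>B\<bar>" by simp
  qed
  then have "nrm E (T ?u) \<le> op_norm E T"
    unfolding op_norm_def using u nu by (intro cSUP_upper) auto
  moreover have "nrm E (T ?u) = (1 / nrm E x) * nrm E (T x)"
    unfolding hom[OF x] nrm_smul[OF E Tx] nc ..
  ultimately have "(1 / nrm E x) * nrm E (T x) \<le> op_norm E T" by linarith
  then show ?thesis using pos by (simp add: field_simps)
qed

lemma R1_IntD:
  assumes XY: "banach_couple smul X Y" and Z: "Z \<in> R1_Int smul X Y"
  shows "banach_space smul Z" "normed_space smul Z"
    "bounded_inclusion (inter_space X Y) Z" "bounded_inclusion Z (sum_space X Y)"
    "carr Z \<subseteq> sum_carr X Y"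
proof -
  show *: "banach_space smul Z" "normed_space smul Z"
    using Z by (simp_all add: R1_Int_def intermediate_def banach_space_def)
  show "bounded_inclusion (inter_space X Y) Z" "bounded_inclusion Z (sum_space X Y)"
    using Z embedded_iff_bounded_inclusion[OF normed_space_inter[OF banach_coupleD(3,4)[OF XY]] *(2)]
      embedded_iff_bounded_inclusion[OF *(2) normed_space_sum[OF XY]]
    by (simp_all add: R1_Int_def intermediate_def)
  then show "carr Z \<subseteq> sum_carr X Y" by (simp add: bounded_inclusion_def)
qed

text \<open>The estimate that links an interpolation space \<open>Z\<close> to the K-functional.  It includes \<open>s = 0\<close>, where the
  functional vanishes on \<open>Y\<close> and the vector \<open>a\<close> may be any element of \<open>X\<close>; then \<open>a \<in> Z\<close> is part of the
  conclusion.\<close>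

lemma rank_one_interpolation_estimate:
  assumes XY: "banach_couple smul X Y" and Z: "Z \<in> R1_Int smul X Y"
  obtains C where "C > 0"
    "\<And>s z a. 0 \<le> s \<Longrightarrow> z \<in> carr Z \<Longrightarrow> a \<in> carr X \<Longrightarrow> s = 0 \<or> a \<in> carr Y \<Longrightarrow> K_functional X Y s z \<noteq> 0 \<Longrightarrow>
      a \<in> carr Z \<and> K_functional X Y s z * nrm Z a \<le> C * max (nrm X a) (s * nrm Y a) * nrm Z z"
proof -
  note X = banach_coupleD(3)[OF XY] and Y = banach_coupleD(4)[OF XY]
  note S = subspace_sum_carr[OF X Y] and S_sup = carr_subset_sum_carr[OF X Y]
  note Zn = R1_IntD(2)[OF XY Z] and ZS = R1_IntD(5)[OF XY Z]
  obtain C where C: "C > 0" "\<And>T. T \<in> rank_one_ops smul X Y \<Longrightarrow> maps_boundedly Z T"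
      "\<And>T. T \<in> rank_one_ops smul X Y \<Longrightarrow> op_norm Z T \<le> C * couple_op_norm X Y T"
    using Z unfolding R1_Int_def by blast
  have "a \<in> carr Z \<and> K_functional X Y s z * nrm Z a \<le> C * max (nrm X a) (s * nrm Y a) * nrm Z z"
    if s: "0 \<le> s" and z: "z \<in> carr Z" and a: "a \<in> carr X" and aY: "s = 0 \<or> a \<in> carr Y"
      and K: "K_functional X Y s z \<noteq> 0" for s z a
  proof (cases "a = 0")
    case True
    then show ?thesis using subspace_0[OF subspace_carr[OF Zn]] by (simp add: nrm_0 X Y Zn)
  next
    case False
    have zS: "z \<in> sum_carr X Y" and aS: "a \<in> sum_carr X Y" using z a ZS S_sup by auto
    have Kpos: "K_functional X Y s z > 0" using K K_functional_nonneg[OF X Y s zS] by simp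
    show ?thesis
    proof (rule Hahn_Banach_seminorm[OF S K_functional_add[OF X Y s] K_functional_smul[OF X Y s] zS])
      fix f assume f_add: "\<And>x y. x \<in> sum_carr X Y \<Longrightarrow> y \<in> sum_carr X Y \<Longrightarrow> f (x + y) = f x + f y"
        and f_smul: "\<And>c x. x \<in> sum_carr X Y \<Longrightarrow> f (smul c x) = c * f x"
        and f_le: "\<And>x. x \<in> sum_carr X Y \<Longrightarrow> norm (f x) \<le> K_functional X Y s x"
        and f_z: "K_functional X Y s z \<le> norm (f z)"
      define T where "T x = smul (f x) a" for x
      have fz: "f z \<noteq> 0" using f_z Kpos by auto
      have TS: "T x \<in> sum_carr X Y" for x
        unfolding T_def using aS subspace_scale[OF S] by blast
      have fX: "norm (f x) \<le> nrm X x" if "x \<in> carr X" for x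
        using f_le[of x] K_functional_left[OF X Y s that] S_sup that by fastforce
      have fY: "norm (f y) \<le> s * nrm Y y" if "y \<in> carr Y" for y
        using f_le[of y] K_functional_right[OF X Y s that] S_sup that by fastforce
      have TX: "T x \<in> carr X \<and> nrm X (T x) \<le> nrm X a * nrm X x" if x: "x \<in> carr X" for x
        using a subspace_scale[OF subspace_carr[OF X]] mult_right_mono[OF fX[OF x] nrm_nonneg[OF X, of a]]
        by (simp add: T_def nrm_smul[OF X a] mult.commute)
      have TY: "T y \<in> carr Y \<and> nrm Y (T y) \<le> (s * nrm Y a) * nrm Y y" if y: "y \<in> carr Y" for y
      proof (cases "s = 0")
        case True
        then have "T y = 0" using fY[OF y] by (simp add: T_def)
        then show ?thesis using subspace_0[OF subspace_carr[OF Y]] True by (simp add: nrm_0[OF Y])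
      next
        case False
        then have "a \<in> carr Y" using aY by blast
        then show ?thesis
          using subspace_scale[OF subspace_carr[OF Y]] mult_right_mono[OF fY[OF y] nrm_nonneg[OF Y, of a]]
          by (simp add: T_def nrm_smul[OF Y] algebra_simps)
      qed
      have "linear_operator_in smul (carr (sum_space X Y)) T"
        unfolding linear_operator_in_def carr_sum_space
        using TS by (auto simp: T_def f_add f_smul scale_left_distrib)
      moreover have "maps_boundedly X T" "maps_boundedly Y T"
        unfolding maps_boundedly_def using TX TY by blast+
      moreover have "dim (T ` carr (sum_space X Y)) = 1"
      proof -
        have "T ` sum_carr X Y = span {a}"
        proof (rule antisym)
          show "T ` sum_carr X Y \<subseteq> span {a}" by (auto simp: T_def span_singleton)
          show "span {a} \<subseteq> T ` sum_carr X Y"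
          proof
            fix b assume "b \<in> span {a}"
            then obtain c where "b = smul c a" by (auto simp: span_singleton)
            then have "b = T (smul (c / f z) z)" using fz by (simp add: T_def f_smul[OF zS])
            then show "b \<in> T ` sum_carr X Y" using subspace_scale[OF S zS] by blast
          qed
        qed
        then show ?thesis using False dim_eq_card_independent[of "{a}"] by simp
      qed
      ultimately have T: "T \<in> rank_one_ops smul X Y"
        by (simp add: rank_one_ops_def couple_ops_def)
      have hom: "T (smul c x) = smul c (T x)" if "x \<in> carr Z" for c x
        using f_smul[of x] that ZS by (auto simp: T_def)
      have "op_norm X T \<le> nrm X a" "op_norm Y T \<le> s * nrm Y a"
        using op_norm_le[OF X nrm_nonneg[OF X, of a], of T] TX
          op_norm_le[OF Y mult_nonneg_nonneg[OF s nrm_nonneg[OF Y, of a]], of T] TY by blast+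
      then have cn: "couple_op_norm X Y T \<le> max (nrm X a) (s * nrm Y a)"
        unfolding couple_op_norm_def by linarith
      have Tz: "T z \<in> carr Z" using C(2)[OF T] z unfolding maps_boundedly_def by blast
      \<comment> \<open>The operator moves \<open>z\<close> to a nonzero multiple of \<open>a\<close>, which forces \<open>a\<close> into \<open>Z\<close>.\<close>
      have "smul (inverse (f z)) (T z) = a" using fz by (simp add: T_def)
      then have aZ: "a \<in> carr Z" using subspace_scale[OF subspace_carr[OF Zn] Tz] by metis
      have "K_functional X Y s z * nrm Z a \<le> norm (f z) * nrm Z a"
        by (intro mult_right_mono f_z nrm_nonneg[OF Zn])
      also have "\<dots> = nrm Z (T z)" by (simp add: T_def nrm_smul[OF Zn aZ])
      also have "\<dots> \<le> op_norm Z T * nrm Z z" by (rule nrm_le_op_norm[OF Zn C(2)[OF T] hom z])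
      also have "\<dots> \<le> (C * couple_op_norm X Y T) * nrm Z z"
        by (intro mult_right_mono C(3)[OF T] nrm_nonneg[OF Zn])
      also have "\<dots> \<le> (C * max (nrm X a) (s * nrm Y a)) * nrm Z z"
        using C(1) by (intro mult_right_mono mult_left_mono cn nrm_nonneg[OF Zn]) simp
      finally show ?thesis using aZ by simp
    qed
  qed
  then show ?thesis using that C(1) by blast
qed

lemma left_in_R1_Int:
  assumes XY: "banach_couple smul X Y"
  shows "X \<in> R1_Int smul X Y"
proof -
  note X = banach_coupleD(3)[OF XY] and Y = banach_coupleD(4)[OF XY]
  have "bounded_inclusion (inter_space X Y) X"
    unfolding bounded_inclusion_def inter_space_def by (auto intro!: exI[of _ 1])
  moreover have "bounded_inclusion X (sum_space X Y)"
    unfolding bounded_inclusion_def carr_sum_space nrm_sum_space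
    using carr_subset_sum_carr[OF X Y] K_functional_left[OF X Y, of 1] by (auto intro!: exI[of _ 1])
  moreover have "op_norm X T \<le> 1 * couple_op_norm X Y T" for T
    by (simp add: couple_op_norm_def)
  ultimately show ?thesis
    unfolding R1_Int_def intermediate_def
    using banach_coupleD(1)[OF XY] embedded_iff_bounded_inclusion[OF normed_space_inter[OF X Y] X]
      embedded_iff_bounded_inclusion[OF X normed_space_sum[OF XY]]
    by (auto simp: rank_one_ops_def couple_ops_def intro!: exI[of _ 1])
qed

lemma sum_carr_commute: "sum_carr X Y = sum_carr Y X"
  unfolding sum_carr_def by (auto; metis add.commute)

lemma sum_space_commute: "sum_space X Y = sum_space Y X"
proof -
  have "{nrm X x + nrm Y y | x y. x \<in> carr X \<and> y \<in> carr Y \<and> z = x + y} =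
        {nrm Y x + nrm X y | x y. x \<in> carr Y \<and> y \<in> carr X \<and> z = x + y}" for z
    by (auto; metis add.commute)
  then show ?thesis unfolding sum_space_def sum_carr_commute[of X Y] by presburger
qed

lemma banach_couple_commute: "banach_couple smul X Y \<longleftrightarrow> banach_couple smul Y X"
  unfolding banach_couple_def by blast

lemma R1_Int_commute: "R1_Int smul X Y = R1_Int smul Y X"
proof -
  have "inter_space X Y = inter_space Y X"
    unfolding inter_space_def by (auto simp: fun_eq_iff max.commute)
  moreover have "couple_op_norm X Y = couple_op_norm Y X"
    unfolding couple_op_norm_def by (simp add: max.commute)
  moreover have "rank_one_ops smul X Y = rank_one_ops smul Y X"
    unfolding rank_one_ops_def couple_ops_def sum_space_commute[of X Y] by blast
  ultimately show ?thesis
    unfolding R1_Int_def intermediate_def sum_space_commute[of X Y] by presburger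
qed

lemma right_in_R1_Int: "banach_couple smul X Y \<Longrightarrow> Y \<in> R1_Int smul X Y"
  using left_in_R1_Int R1_Int_commute banach_couple_commute by metis

section \<open>The dichotomy for a space of a couple\<close>

text \<open>A small value of \<open>K(s, x)\<close> means that \<open>x\<close> is, up to an error of at most half its norm in \<open>X\<close>, an element
  of \<open>X \<inter> Y\<close> whose norm in \<open>Y\<close> is controlled; the approximation is iterated.\<close>

lemma K_functional_small_imp_bounded_inclusion:
  assumes XY: "banach_couple smul X Y" and s: "s > 0"
    and small: "\<And>x. x \<in> carr X \<Longrightarrow> K_functional X Y s x \<le> nrm X x / 4"
  shows "bounded_inclusion X Y"
proof -
  note X = banach_coupleD(3)[OF XY] and Y = banach_coupleD(4)[OF XY]
  show ?thesis
  proof (rule bounded_inclusion_from_approximation[OF X banach_coupleD(2)[OF XY] normed_space_sum[OF XY]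
        R1_IntD(4)[OF XY left_in_R1_Int[OF XY]] R1_IntD(4)[OF XY right_in_R1_Int[OF XY]], of "1/2" "1/(2 * s)"])
    fix x assume x: "x \<in> carr X"
    show "\<exists>y\<in>carr X \<inter> carr Y. nrm X (x - y) \<le> 1/2 * nrm X x \<and> nrm Y y \<le> 1/(2 * s) * nrm X x"
    proof (cases "x = 0")
      case True
      then show ?thesis using subspace_0 subspace_carr X Y by (intro bexI[of _ 0]) (auto simp: nrm_0)
    next
      case False
      then have "nrm X x > 0" using nrm_eq_0[OF X x] nrm_nonneg[OF X, of x] by simp
      \<comment> \<open>Passing from \<open>1/4\<close> to \<open>1/2\<close> leaves room for a decomposition that does not attain the infimum.\<close>
      then have "K_functional X Y s x < nrm X x / 2" using small[OF x] by simp
      then obtain x' y where xy: "x' \<in> carr X" "y \<in> carr Y" "x = x' + y" "nrm X x' + s * nrm Y y < nrm X x / 2"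
        using K_functional_lessE carr_subset_sum_carr(1)[OF X Y] x by (metis subsetD)
      have "y = x - x'" using xy(3) by simp
      then have "y \<in> carr X" using x xy(1) subspace_diff[OF subspace_carr[OF X]] by simp
      moreover have "x - y = x'" using xy(3) by simp
      moreover have "nrm X x' \<le> nrm X x / 2" "s * nrm Y y \<le> nrm X x / 2"
        using xy(4) nrm_nonneg[OF X, of x'] mult_nonneg_nonneg[of s "nrm Y y"] s nrm_nonneg[OF Y, of y] by linarith+
      ultimately show ?thesis using xy(2) s by (intro bexI[of _ y]) (auto simp: field_simps)
    qed
  qed auto
qed

text \<open>The two cases are whether \<open>X \<inter> Y\<close> is dense in \<open>X\<close>, which is the vanishing of \<open>K(0, _)\<close> on \<open>X\<close>.  Without
  density, operators of rank one vanishing on \<open>Y\<close> move an element of \<open>V\<close> or \<open>W\<close> to every element of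
  \<open>X\<close>.  With density, only the norms on \<open>X \<inter> Y\<close> have to be compared, and small \<open>s\<close> are used.\<close>

lemma bounded_inclusion_into_one_of_two:
  assumes XY: "banach_couple smul X Y" and VW: "banach_couple smul V W"
    and V: "V \<in> R1_Int smul X Y" and W: "W \<in> R1_Int smul X Y"
    and X_VW: "bounded_inclusion X (sum_space V W)"
    and not_XY: "\<not> bounded_inclusion X Y"
  shows "bounded_inclusion X V \<or> bounded_inclusion X W"
proof -
  note Xn = banach_coupleD(3)[OF XY] and Yn = banach_coupleD(4)[OF XY]
  note Vn = banach_coupleD(3)[OF VW] and Wn = banach_coupleD(4)[OF VW]
  note XS = carr_subset_sum_carr(1)[OF Xn Yn]
  have VS: "carr V \<subseteq> sum_carr X Y" and WS: "carr W \<subseteq> sum_carr X Y"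
    using R1_IntD(5)[OF XY] V W by auto
  show ?thesis
  proof (cases "\<exists>x\<in>carr X. K_functional X Y 0 x \<noteq> 0")
    case True
    then obtain x where x: "x \<in> carr X" "K_functional X Y 0 x \<noteq> 0" by blast
    then have "x \<in> sum_carr V W" using X_VW by (auto simp: bounded_inclusion_def)
    then obtain v w where vw: "v \<in> carr V" "w \<in> carr W" "x = v + w" by (auto simp: sum_carr_def)
    have "K_functional X Y 0 v \<noteq> 0 \<or> K_functional X Y 0 w \<noteq> 0"
    proof -
      have "v \<in> sum_carr X Y" "w \<in> sum_carr X Y" "x \<in> sum_carr X Y" using vw x VS WS XS by auto
      then show ?thesis
        using K_functional_add[OF Xn Yn order_refl, of v w] K_functional_nonneg[OF Xn Yn order_refl, of x] vw(3) x(2)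
        by fastforce
    qed
    moreover have incl: "bounded_inclusion X Z"
      if Z: "Z \<in> R1_Int smul X Y" and z: "z \<in> carr Z" "K_functional X Y 0 z \<noteq> 0" for Z z
    proof -
      obtain C where "C > 0" and C: "\<And>a. a \<in> carr X \<Longrightarrow> a \<in> carr Z \<and>
          K_functional X Y 0 z * nrm Z a \<le> C * max (nrm X a) (0 * nrm Y a) * nrm Z z"
        using rank_one_interpolation_estimate[OF XY Z] z by (metis order_refl)
      have "z \<in> sum_carr X Y" using z R1_IntD(5)[OF XY Z] by blast
      then have pos: "K_functional X Y 0 z > 0"
        using z K_functional_nonneg[OF Xn Yn order_refl] by fastforce
      have "nrm Z a \<le> (C * nrm Z z / K_functional X Y 0 z) * nrm X a" if "a \<in> carr X" for a
        using C[OF that] pos nrm_nonneg[OF Xn, of a] by (simp add: field_simps)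
      then show ?thesis using C unfolding bounded_inclusion_def by blast
    qed
    ultimately show ?thesis using V W vw by blast
  next
    case False
    then have dense0: "K_functional X Y 0 x = 0" if "x \<in> carr X" for x using that by blast
    have dense: "\<exists>a\<in>carr X \<inter> carr Y. nrm X (x - a) < e" if x: "x \<in> carr X" and e: "e > 0" for x e
    proof -
      have "K_functional X Y 0 x < e" using dense0[OF x] e by simp
      then obtain x' y where xy: "x' \<in> carr X" "y \<in> carr Y" "x = x' + y" "nrm X x' + 0 * nrm Y y < e"
        using K_functional_lessE XS x by (metis subsetD)
      have "y = x - x'" using xy(3) by simp
      then have "y \<in> carr X" using x xy(1) subspace_diff[OF subspace_carr[OF Xn]] by simp
      moreover have "x - y = x'" using xy(3) by simp
      ultimately show ?thesis using xy by (intro bexI[of _ y]) auto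
    qed
    have incl: "bounded_inclusion X Z"
      if Z: "Z \<in> R1_Int smul X Y" and c: "c > 0" and
        big: "\<And>s. s > 0 \<Longrightarrow> \<exists>z\<in>carr Z. K_functional X Y s z > c * nrm Z z" for Z c
    proof -
      note Zn = R1_IntD(2)[OF XY Z]
      obtain C where "C > 0" and C: "\<And>s z a. 0 \<le> s \<Longrightarrow> z \<in> carr Z \<Longrightarrow> a \<in> carr X \<Longrightarrow> s = 0 \<or> a \<in> carr Y \<Longrightarrow>
          K_functional X Y s z \<noteq> 0 \<Longrightarrow>
          a \<in> carr Z \<and> K_functional X Y s z * nrm Z a \<le> C * max (nrm X a) (s * nrm Y a) * nrm Z z"
        using rank_one_interpolation_estimate[OF XY Z] by blast
      have est: "c * nrm Z a \<le> C * max (nrm X a) (s * nrm Y a)"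
        if a: "a \<in> carr X" "a \<in> carr Y" and s: "s > 0" for a s
      proof -
        obtain z where z: "z \<in> carr Z" "K_functional X Y s z > c * nrm Z z" using big[OF s] by blast
        have Kz: "K_functional X Y s z \<noteq> 0"
          using z c mult_nonneg_nonneg[of c "nrm Z z"] nrm_nonneg[OF Zn, of z] by linarith
        have "z \<noteq> 0"
        proof
          assume "z = 0"
          then show False
            using Kz K_functional_smul[OF Xn Yn, of s z 0] s z R1_IntD(5)[OF XY Z] by auto
        qed
        then have pos: "nrm Z z > 0" using nrm_eq_0[OF Zn z(1)] nrm_nonneg[OF Zn, of z] by simp
        have "(c * nrm Z z) * nrm Z a \<le> K_functional X Y s z * nrm Z a"
          using z(2) by (intro mult_right_mono nrm_nonneg[OF Zn]) simp
        also have "\<dots> \<le> C * max (nrm X a) (s * nrm Y a) * nrm Z z"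
          using C[of s z a] z a s Kz by auto
        finally have "nrm Z z * (c * nrm Z a) \<le> nrm Z z * (C * max (nrm X a) (s * nrm Y a))"
          by (simp add: mult_ac)
        then show ?thesis using pos by simp
      qed
      have bound: "nrm Z a \<le> (C / c) * nrm X a" if a: "a \<in> carr X \<inter> carr Y" for a
      proof (cases "a = 0")
        case True then show ?thesis by (simp add: nrm_0 Xn Zn)
      next
        case False
        then have "nrm X a > 0" "nrm Y a > 0"
          using a nrm_eq_0[OF Xn, of a] nrm_eq_0[OF Yn, of a] nrm_nonneg[OF Xn, of a] nrm_nonneg[OF Yn, of a] by auto
        then have "c * nrm Z a \<le> C * nrm X a"
          \<comment> \<open>At this \<open>s\<close> the maximum in the estimate equals the norm of \<open>a\<close> in \<open>X\<close>.\<close>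
          using est[of a "nrm X a / nrm Y a"] a by simp
        then show ?thesis using c by (simp add: field_simps)
      qed
      have sub: "carr X \<inter> carr Y \<subseteq> carr Z"
        using R1_IntD(3)[OF XY Z] by (simp add: bounded_inclusion_def inter_space_def)
      show ?thesis
        by (rule bounded_inclusion_from_dense[OF Xn R1_IntD(1)[OF XY Z] normed_space_sum[OF XY]
              R1_IntD(4)[OF XY left_in_R1_Int[OF XY]] R1_IntD(4)[OF XY Z]
              subspace_inter[OF subspace_carr[OF Xn] subspace_carr[OF Yn]] Int_lower1 sub dense bound])
    qed
    obtain D where D: "D > 0" "\<And>x. x \<in> carr X \<Longrightarrow> nrm (sum_space V W) x \<le> D * nrm X x"
      using bounded_inclusionE[OF X_VW Xn] by blast
    \<comment> \<open>Chosen so that \<open>K(s, _) \<le> c \<parallel>_\<parallel>\<close> on \<open>V\<close> and \<open>W\<close> gives \<open>K(s, x) \<le> \<parallel>x\<parallel> / 4\<close> on \<open>X\<close>.\<close>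
    define c where "c = 1 / (4 * D)"
    have c: "c > 0" using D by (simp add: c_def)
    have "\<not> ((\<exists>s>0. \<forall>v\<in>carr V. K_functional X Y s v \<le> c * nrm V v) \<and>
             (\<exists>s>0. \<forall>w\<in>carr W. K_functional X Y s w \<le> c * nrm W w))"
    proof
      assume "(\<exists>s>0. \<forall>v\<in>carr V. K_functional X Y s v \<le> c * nrm V v) \<and>
             (\<exists>s>0. \<forall>w\<in>carr W. K_functional X Y s w \<le> c * nrm W w)"
      then obtain s1 s2 where s1: "s1 > 0" "\<And>v. v \<in> carr V \<Longrightarrow> K_functional X Y s1 v \<le> c * nrm V v"
        and s2: "s2 > 0" "\<And>w. w \<in> carr W \<Longrightarrow> K_functional X Y s2 w \<le> c * nrm W w" by blast
      \<comment> \<open>The K-functional increases with \<open>s\<close>, so one parameter serves both spaces.\<close>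
      define s where "s = min s1 s2"
      have s: "s > 0" "s \<le> s1" "s \<le> s2" using s1 s2 by (auto simp: s_def)
      have "K_functional X Y s x \<le> nrm X x / 4" if x: "x \<in> carr X" for x
      proof -
        have xS: "x \<in> sum_carr V W" using x X_VW by (auto simp: bounded_inclusion_def)
        have "K_functional X Y s x / c \<le> K_functional V W 1 x"
        proof (rule K_functional_greatest[OF xS])
          fix v w assume vw: "v \<in> carr V" "w \<in> carr W" "x = v + w"
          have vS: "v \<in> sum_carr X Y" and wS: "w \<in> sum_carr X Y" using vw VS WS by auto
          have "K_functional X Y s x \<le> K_functional X Y s v + K_functional X Y s w"
            unfolding vw(3) using s by (intro K_functional_add[OF Xn Yn _ vS wS]) simp
          also have "\<dots> \<le> K_functional X Y s1 v + K_functional X Y s2 w"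
            using s by (intro add_mono K_functional_mono[OF Xn Yn] vS wS) auto
          also have "\<dots> \<le> c * nrm V v + c * nrm W w" by (intro add_mono s1 s2 vw)
          finally show "K_functional X Y s x / c \<le> nrm V v + 1 * nrm W w"
            using c by (simp add: field_simps)
        qed
        also have "\<dots> \<le> D * nrm X x" using D(2)[OF x] xS by (simp add: nrm_sum_space)
        finally show ?thesis using c D(1) by (simp add: c_def field_simps)
      qed
      then show False using K_functional_small_imp_bounded_inclusion[OF XY s(1)] not_XY by blast
    qed
    then have "(\<forall>s>0. \<exists>v\<in>carr V. K_functional X Y s v > c * nrm V v) \<or>
               (\<forall>s>0. \<exists>w\<in>carr W. K_functional X Y s w > c * nrm W w)"
      by (meson not_le)
    then show ?thesis using incl[OF V c] incl[OF W c] by blast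
  qed
qed

end

section \<open>Uniqueness of the couple\<close>

text \<open>Here \<open>le\<close> is a preorder in which \<open>{x, y}\<close> and \<open>{v, w}\<close> have the same lower and the same upper bounds
  in \<open>N\<close>.  If both pairs are comparable, they match, since the greater elements are least upper bounds
  and the smaller ones greatest lower bounds.  If both are incomparable, say \<open>le x v\<close>; then \<open>le y v\<close>
  would make \<open>v\<close> an upper bound of both pairs, so \<open>le y w\<close>, and \<open>le v y\<close> would give \<open>le x y\<close>, so \<open>le v x\<close>,
  and likewise \<open>le w y\<close>.  It cannot happen that only \<open>{x, y}\<close> is incomparable: if, say, \<open>le w v\<close>, then
  \<open>v\<close> is an upper bound of \<open>{x, y}\<close>; either \<open>le v w\<close>, and then everything is equivalent, or \<open>v\<close> lies below
  \<open>x\<close> or \<open>y\<close>, and both make \<open>x\<close> and \<open>y\<close> comparable.\<close>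

lemma pairs_match_in_preorder:
  fixes le :: "'b \<Rightarrow> 'b \<Rightarrow> bool"
  assumes N: "x \<in> N" "y \<in> N" "v \<in> N" "w \<in> N"
    and refl: "\<And>e. le e e"
    and trans: "\<And>e f g. e \<in> N \<Longrightarrow> f \<in> N \<Longrightarrow> g \<in> N \<Longrightarrow> le e f \<Longrightarrow> le f g \<Longrightarrow> le e g"
    and inter: "\<And>e. e \<in> N \<Longrightarrow> le e v \<and> le e w \<longleftrightarrow> le e x \<and> le e y"
    and sum: "\<And>f. f \<in> N \<Longrightarrow> le v f \<and> le w f \<longleftrightarrow> le x f \<and> le y f"
    and split: "le x y \<or> le x v \<or> le x w" "le y x \<or> le y v \<or> le y w"
      "le v w \<or> le v x \<or> le v y" "le w v \<or> le w x \<or> le w y"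
  shows "(le x v \<and> le v x \<and> le y w \<and> le w y) \<or> (le x w \<and> le w x \<and> le y v \<and> le v y)"
proof -
  note i = inter[OF N(1)] inter[OF N(2)] inter[OF N(3)] inter[OF N(4)]
  note s = sum[OF N(1)] sum[OF N(2)] sum[OF N(3)] sum[OF N(4)]
  note r = refl[of x] refl[of y] refl[of v] refl[of w]
  consider "le x y \<or> le y x" "le v w \<or> le w v" | "\<not> le x y" "\<not> le y x" "le v w \<or> le w v"
    | "le x y \<or> le y x" "\<not> le v w" "\<not> le w v" | "\<not> le x y" "\<not> le y x" "\<not> le v w" "\<not> le w v" by blast
  then show ?thesis
  proof cases
    case 1
    then show ?thesis using i s r by argo
  next
    case 2
    then show ?thesis using i s r split trans[of _ _ x] trans[of _ _ y] N by metis
  next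
    case 3
    then show ?thesis using i s r split trans[of _ _ v] trans[of _ _ w] N by metis
  next
    case 4
    then show ?thesis using i s r split trans N by metis
  qed
qed

theorem theorem2p8:
  fixes smul :: "'k::real_or_complex_field \<Rightarrow> 'a::ab_group_add \<Rightarrow> 'a"
    and X Y V W :: "'a nspace"
  assumes "vector_space smul"
    and "banach_couple smul X Y"
    and "banach_couple smul V W"
    and "R1_Int smul X Y = R1_Int smul V W"
  shows "(space_equiv X V \<and> space_equiv Y W) \<or> (space_equiv X W \<and> space_equiv Y V)"
proof -
  interpret rc_vector_space smul using assms(1) by (simp add: rc_vector_space_def)
  note XY = assms(2) and VW = assms(3) and eq = assms(4)
  note YX = XY[unfolded banach_couple_commute[of X Y]] and WV = VW[unfolded banach_couple_commute[of V W]]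
  let ?N = "R1_Int smul X Y"
  have normed: "normed_space smul E" if "E \<in> ?N" for E using that by (rule R1_IntD[OF XY])
  have N: "X \<in> ?N" "Y \<in> ?N" "V \<in> ?N" "W \<in> ?N"
    using left_in_R1_Int[OF XY] right_in_R1_Int[OF XY] left_in_R1_Int[OF VW] right_in_R1_Int[OF VW] eq by auto
  have inter: "bounded_inclusion E A"
    if "banach_couple smul P Q" "R1_Int smul P Q = ?N" "bounded_inclusion E P" "bounded_inclusion E Q"
      "E \<in> ?N" "A \<in> ?N" for E A P Q
  proof -
    have "bounded_inclusion (inter_space P Q) A" using R1_IntD(3)[OF that(1)] that by simp
    then show ?thesis
      using bounded_inclusion_trans[OF bounded_inclusion_inter[OF that(3,4) normed]] that normed
        normed_space_inter[OF banach_coupleD(3,4)[OF that(1)]] by blast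
  qed
  have sum: "bounded_inclusion A F"
    if "banach_couple smul P Q" "R1_Int smul P Q = ?N" "bounded_inclusion P F" "bounded_inclusion Q F"
      "F \<in> ?N" "A \<in> ?N" for F A P Q
  proof -
    have "bounded_inclusion A (sum_space P Q)" using R1_IntD(4)[OF that(1)] that by simp
    then show ?thesis
      using bounded_inclusion_trans[OF _ bounded_inclusion_sum[OF that(1) normed that(3,4)]] that normed
        normed_space_sum[OF that(1)] by blast
  qed
  have split: "bounded_inclusion A B \<or> bounded_inclusion A P \<or> bounded_inclusion A Q"
    if "banach_couple smul A B" "R1_Int smul A B = ?N" "banach_couple smul P Q" "R1_Int smul P Q = ?N" for A B P Q
    using bounded_inclusion_into_one_of_two[OF that(1,3)] R1_IntD(4)[OF that(3)]
      left_in_R1_Int[OF that(1)] left_in_R1_Int[OF that(3)] right_in_R1_Int[OF that(3)] that by auto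
  have comm: "R1_Int smul Y X = ?N" "R1_Int smul W V = ?N" "R1_Int smul V W = ?N"
    using eq R1_Int_commute by metis+
  have "(bounded_inclusion X V \<and> bounded_inclusion V X \<and> bounded_inclusion Y W \<and> bounded_inclusion W Y) \<or>
      (bounded_inclusion X W \<and> bounded_inclusion W X \<and> bounded_inclusion Y V \<and> bounded_inclusion V Y)"
  proof (rule pairs_match_in_preorder[OF N])
    show "bounded_inclusion E E" for E :: "'a nspace"
      unfolding bounded_inclusion_def by (auto intro: exI[of _ 1])
    show "bounded_inclusion E G" if "E \<in> ?N" "F \<in> ?N" "G \<in> ?N" "bounded_inclusion E F" "bounded_inclusion F G" for E F G
      using bounded_inclusion_trans that normed by blast
    show "bounded_inclusion E V \<and> bounded_inclusion E W \<longleftrightarrow> bounded_inclusion E X \<and> bounded_inclusion E Y"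
      if "E \<in> ?N" for E
      using inter[OF XY refl _ _ that] inter[OF VW comm(3) _ _ that] N by blast
    show "bounded_inclusion V F \<and> bounded_inclusion W F \<longleftrightarrow> bounded_inclusion X F \<and> bounded_inclusion Y F"
      if "F \<in> ?N" for F
      using sum[OF XY refl _ _ that] sum[OF VW comm(3) _ _ that] N by blast
    show "bounded_inclusion X Y \<or> bounded_inclusion X V \<or> bounded_inclusion X W"
      by (rule split[OF XY refl VW comm(3)])
    show "bounded_inclusion Y X \<or> bounded_inclusion Y V \<or> bounded_inclusion Y W"
      by (rule split[OF YX comm(1) VW comm(3)])
    show "bounded_inclusion V W \<or> bounded_inclusion V X \<or> bounded_inclusion V Y"
      by (rule split[OF VW comm(3) XY refl])
    show "bounded_inclusion W V \<or> bounded_inclusion W X \<or> bounded_inclusion W Y"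
      by (rule split[OF WV comm(2) XY refl])
  qed
  then show ?thesis using space_equiv_if_bounded_inclusions normed N by blast
qed

end
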